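(* Let $G=(V_G,E_G)$ be a simple graph with $V_G=\{1,\dots,n\}$ and $|E_G|\geq 2$, and let $\mathbb{K}$ be a field. Choose $\ell\in E_G$. For each $(T,p)\in\mathcal{T}_G^*$, choose a set $\mathcal{S}(T,p)\subseteq\mathcal{J}^*(T,p)$ of representatives of the equivalence classes of $\sim$ in $\mathcal{J}^*(T,p)$ (one from each class) and choose $K(T,p)\in\mathcal{S}(T,p)$. Then the set $$\{t_e^2-t_\ell^2 : e\in E_G\setminus\{\ell\}\}\ \cup\bigcup_{(T,p)\in\mathcal{T}_G^*}\{\mathbf{t}_J-\mathbf{t}_{K(T,p)} : J\in\mathcal{S}(T,p)\setminus\{K(T,p)\}\}$$ is a minimal homogeneous generating set of the Eulerian ideal $I(G)$.
   Context: $\mathbb{K}[E_G]=\mathbb{K}[t_e: e\in E_G]$ is the (standard graded) polynomial ring with one variable for each edge of $G$; for $J\subseteq E_G$, $\mathbf{t}_J=\prod_{e\in J}t_e$. Eulerian ideal: let $\varphi:\mathbb{K}[E_G]\to\mathbb{K}[x_1,\dots,x_n]$ be the $\mathbb{K}$-algebra homomorphism with $t_e\mapsto x_ix_j$ for every edge $e=\{i,j\}$. Then $I(G)=\varphi^{-1}\bigl((x_i^2-x_j^2 : i,j\in V_G)\bigr)$. Joins: for $J\subseteq E_G$ and $i\in V_G$, $\deg_J(i)$ is the number of edges in $J$ containing $i$. For $T\subseteq V_G$ and $p\in\mathbb{Z}_2=\mathbb{Z}/2\mathbb{Z}$, a $(T,p)$-join is a subset $J\subseteq E_G$ such that $T=\{v\in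 V_G:\deg_J(v)\text{ is odd}\}$ and $|J|+2\mathbb{Z}=p$. $\mathcal{T}_G$ is the set of all pairs $(T,p)$ for which a $(T,p)$-join exists. For $(T,p)\in\mathcal{T}_G$, $\mathcal{J}^*(T,p)$ denotes the set of all $(T,p)$-joins of minimum cardinality (among all $(T,p)$-joins). Equivalence: for $J,K\in\mathcal{J}^*(T,p)$, write $J\sim K$ if there exist $r\ge 0$ and $L^0,L^1,\dots,L^r\in\mathcal{J}^*(T,p)$ with $L^0=J$, $L^r=K$ and $L^i\cap L^{i+1}\neq\emptyset$ for all $0\le i\le r-1$. This is an equivalence relation on $\mathcal{J}^*(T,p)$. $\mathcal{T}_G^*$ is the set of all $(T,p)\in\mathcal{T}_G$ for which there are at least two nonequivalent elements of $\mathcal{J}^*(T,p)$. *)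

theory Defs
  imports "HOL-Library.Poly_Mapping" "HOL-Library.Z2" "HOL-Algebra.Ideal" "HOL-Algebra.RingHom"
begin

section \<open>Polynomial rings\<close>

text \<open>
  A polynomial is a finitely supported function from monomials to coefficients, a monomial being a
  finitely supported function from variables to exponents. The set of variables actually allowed
  is the parameter of \<open>poly_ring\<close>, so that \<open>poly_ring X\<close> is \<open>K[x : x \<in> X]\<close>.
\<close>

type_synonym ('v, 'k) mpoly = "('v \<Rightarrow>\<^sub>0 nat) \<Rightarrow>\<^sub>0 'k"

definition var :: "'v \<Rightarrow> ('v, 'k::comm_ring_1) mpoly" where
  "var x = Poly_Mapping.single (Poly_Mapping.single x 1) 1"

definition const :: "'k \<Rightarrow> ('v, 'k::comm_ring_1) mpoly" where
  "const c = Poly_Mapping.single 0 c"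

definition poly_ring :: "'v set \<Rightarrow> ('v, 'k::comm_ring_1) mpoly ring" where
  "poly_ring X =
     \<lparr>carrier = {f. \<forall>m\<in>Poly_Mapping.keys f. Poly_Mapping.keys m \<subseteq> X},
      mult = (*), one = 1, zero = 0, add = (+)\<rparr>"

definition mono_subst :: "('v \<Rightarrow> ('w, 'k::comm_ring_1) mpoly) \<Rightarrow> ('v \<Rightarrow>\<^sub>0 nat) \<Rightarrow> ('w, 'k) mpoly" where
  "mono_subst g m = (\<Prod>x\<in>Poly_Mapping.keys m. g x ^ Poly_Mapping.lookup m x)"

text \<open>
  The \<open>K\<close>-algebra homomorphism determined by \<open>var x \<mapsto> g x\<close>; see \<open>poly_subst_hom\<close>,
  \<open>poly_subst_const\<close> and \<open>poly_subst_var\<close> below.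
\<close>

definition poly_subst :: "('v \<Rightarrow> ('w, 'k::comm_ring_1) mpoly) \<Rightarrow> ('v, 'k) mpoly \<Rightarrow> ('w, 'k) mpoly" where
  "poly_subst g f = (\<Sum>m\<in>Poly_Mapping.keys f. const (Poly_Mapping.lookup f m) * mono_subst g m)"

definition mono_degree :: "('v \<Rightarrow>\<^sub>0 nat) \<Rightarrow> nat" where
  "mono_degree m = (\<Sum>x\<in>Poly_Mapping.keys m. Poly_Mapping.lookup m x)"

definition homogeneous :: "('v, 'k::comm_ring_1) mpoly \<Rightarrow> bool" where
  "homogeneous f \<longleftrightarrow> (\<exists>d. \<forall>m\<in>Poly_Mapping.keys f. mono_degree m = d)"

text \<open>Minimality is with respect to inclusion.\<close>

definition minimal_homogeneous_generating_set ::
    "'v set \<Rightarrow> ('v, 'k::comm_ring_1) mpoly set \<Rightarrow> ('v, 'k) mpoly set \<Rightarrow> bool" where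
  "minimal_homogeneous_generating_set X I B \<longleftrightarrow>
     B \<subseteq> carrier (poly_ring X) \<and>
     (\<forall>b\<in>B. homogeneous b) \<and>
     Idl\<^bsub>poly_ring X\<^esub> B = I \<and>
     (\<forall>B'. B' \<subset> B \<longrightarrow> Idl\<^bsub>poly_ring X\<^esub> B' \<noteq> I)"


section \<open>Graphs and the Eulerian ideal\<close>

definition simple_graph :: "'a set \<Rightarrow> 'a set set \<Rightarrow> bool" where
  "simple_graph V E \<longleftrightarrow> finite V \<and> E \<subseteq> {e. e \<subseteq> V \<and> card e = 2}"

text \<open>\<open>t\<^sub>e \<mapsto> x\<^sub>i x\<^sub>j\<close> for \<open>e = {i, j}\<close>.\<close>

definition edge_map :: "('a set, 'k::comm_ring_1) mpoly \<Rightarrow> ('a, 'k) mpoly" where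
  "edge_map = poly_subst (\<lambda>e. \<Prod>i\<in>e. var i)"

definition eulerian_ideal :: "'a set \<Rightarrow> 'a set set \<Rightarrow> ('a set, 'k::comm_ring_1) mpoly set" where
  "eulerian_ideal V E =
     {f \<in> carrier (poly_ring E).
        edge_map f \<in> Idl\<^bsub>poly_ring V\<^esub> {(var i)\<^sup>2 - (var j)\<^sup>2 | i j. i \<in> V \<and> j \<in> V}}"

definition edge_monom :: "'a set set \<Rightarrow> ('a set, 'k::comm_ring_1) mpoly" where
  "edge_monom J = (\<Prod>e\<in>J. var e)"


section \<open>Joins\<close>

definition deg :: "'a set set \<Rightarrow> 'a \<Rightarrow> nat" where
  "deg J v = card {e \<in> J. v \<in> e}"

text \<open>The type \<^typ>\<open>bit\<close> is the field \<open>\<int>/2\<int>\<close>, and \<open>of_nat\<close> is reduction modulo 2.\<close>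

definition joins :: "'a set \<Rightarrow> 'a set set \<Rightarrow> 'a set \<Rightarrow> bit \<Rightarrow> 'a set set set" where
  "joins V E T p = {J. J \<subseteq> E \<and> T = {v \<in> V. odd (deg J v)} \<and> of_nat (card J) = p}"

definition join_pairs :: "'a set \<Rightarrow> 'a set set \<Rightarrow> ('a set \<times> bit) set" where
  "join_pairs V E = {(T, p). T \<subseteq> V \<and> joins V E T p \<noteq> {}}"

definition min_joins :: "'a set \<Rightarrow> 'a set set \<Rightarrow> 'a set \<Rightarrow> bit \<Rightarrow> 'a set set set" where
  "min_joins V E T p = {J \<in> joins V E T p. \<forall>J'\<in>joins V E T p. card J \<le> card J'}"

definition join_equiv :: "'a set \<Rightarrow> 'a set set \<Rightarrow> 'a set \<Rightarrow> bit \<Rightarrow> ('a set set \<times> 'a set set) set" where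
  "join_equiv V E T p =
     {(J, K). J \<in> min_joins V E T p \<and> K \<in> min_joins V E T p \<and>
        (\<exists>r (L :: nat \<Rightarrow> 'a set set).
           (\<forall>i\<le>r. L i \<in> min_joins V E T p) \<and> L 0 = J \<and> L r = K \<and>
           (\<forall>i<r. L i \<inter> L (Suc i) \<noteq> {}))}"

definition join_pairs_star :: "'a set \<Rightarrow> 'a set set \<Rightarrow> ('a set \<times> bit) set" where
  "join_pairs_star V E =
     {(T, p) \<in> join_pairs V E.
        \<exists>J\<in>min_joins V E T p. \<exists>K\<in>min_joins V E T p. (J, K) \<notin> join_equiv V E T p}"

definition join_representatives ::
    "'a set \<Rightarrow> 'a set set \<Rightarrow> 'a set \<Rightarrow> bit \<Rightarrow> 'a set set set \<Rightarrow> bool" where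
  "join_representatives V E T p S \<longleftrightarrow>
     S \<subseteq> min_joins V E T p \<and>
     (\<forall>C \<in> min_joins V E T p // join_equiv V E T p. \<exists>!J. J \<in> S \<inter> C)"


section \<open>Basic facts\<close>

lemma join_equiv_equiv: "equiv (min_joins V E T p) (join_equiv V E T p)"
proof (rule equivI)
  show "join_equiv V E T p \<subseteq> min_joins V E T p \<times> min_joins V E T p"
    by (auto simp: join_equiv_def)
  show "refl_on (min_joins V E T p) (join_equiv V E T p)"
  proof (rule refl_onI)
    fix J assume "J \<in> min_joins V E T p"
    then show "(J, J) \<in> join_equiv V E T p"
      unfolding join_equiv_def mem_Collect_eq case_prod_conv
      by (intro conjI exI[of _ "0::nat"] exI[of _ "\<lambda>_. J"]) simp_all
  qed
  show "sym (join_equiv V E T p)"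
  proof (rule symI)
    fix J K assume "(J, K) \<in> join_equiv V E T p"
    then obtain r and L :: "nat \<Rightarrow> 'a set set" where
      L: "J \<in> min_joins V E T p" "K \<in> min_joins V E T p"
         "\<forall>i\<le>r. L i \<in> min_joins V E T p" "L 0 = J" "L r = K" "\<forall>i<r. L i \<inter> L (Suc i) \<noteq> {}"
      unfolding join_equiv_def by auto
    have "L (r - i) \<inter> L (r - Suc i) \<noteq> {}" if "i < r" for i
    proof -
      have "L (r - Suc i) \<inter> L (Suc (r - Suc i)) \<noteq> {}" using L(6) that by simp
      then show ?thesis using that by (simp add: Suc_diff_Suc Int_commute)
    qed
    then show "(K, J) \<in> join_equiv V E T p"
      using L unfolding join_equiv_def mem_Collect_eq case_prod_conv
      by (intro conjI exI[of _ r] exI[of _ "\<lambda>i. L (r - i)"]) simp_all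
  qed
  show "trans (join_equiv V E T p)"
  proof (rule transI)
    fix J K M assume "(J, K) \<in> join_equiv V E T p" "(K, M) \<in> join_equiv V E T p"
    then obtain r s and L L' :: "nat \<Rightarrow> 'a set set" where
      L: "J \<in> min_joins V E T p" "M \<in> min_joins V E T p"
         "\<forall>i\<le>r. L i \<in> min_joins V E T p" "L 0 = J" "L r = K" "\<forall>i<r. L i \<inter> L (Suc i) \<noteq> {}"
      and L': "\<forall>i\<le>s. L' i \<in> min_joins V E T p" "L' 0 = K" "L' s = M"
         "\<forall>i<s. L' i \<inter> L' (Suc i) \<noteq> {}"
      unfolding join_equiv_def by auto
    define N where "N i = (if i \<le> r then L i else L' (i - r))" for i
    have "\<forall>i\<le>r + s. N i \<in> min_joins V E T p"
      using L(3) L'(1) by (auto simp: N_def)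
    moreover have "N 0 = J" using L(4) by (simp add: N_def)
    moreover have "N (r + s) = M" using L(5) L'(2,3) by (auto simp: N_def)
    moreover have "N i \<inter> N (Suc i) \<noteq> {}" if "i < r + s" for i
    proof -
      consider "i < r" | "i = r" | "i > r" by linarith
      then show ?thesis
      proof cases
        case 1 then show ?thesis using L(6) by (simp add: N_def)
      next
        case 2
        then have "L' 0 \<inter> L' (Suc 0) \<noteq> {}" using L'(4) that by simp
        then show ?thesis using 2 L(5) L'(2) by (simp add: N_def)
      next
        case 3
        then have "L' (i - r) \<inter> L' (Suc (i - r)) \<noteq> {}" using L'(4) that by simp
        then show ?thesis using 3 by (simp add: N_def Suc_diff_le)
      qed
    qed
    ultimately show "(J, M) \<in> join_equiv V E T p"
      using L(1,2) unfolding join_equiv_def by blast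
  qed
qed

lemma poly_ring_cring: "cring (poly_ring X :: ('v, 'k::comm_ring_1) mpoly ring)"
proof -
  let ?C = "{f :: ('v, 'k) mpoly. \<forall>m\<in>Poly_Mapping.keys f. Poly_Mapping.keys m \<subseteq> X}"
  have add: "f + g \<in> ?C" if "f \<in> ?C" "g \<in> ?C" for f g
    using that Poly_Mapping.keys_add[of f g] by blast
  have mult: "f * g \<in> ?C" if fg: "f \<in> ?C" "g \<in> ?C" for f g
  proof -
    have "Poly_Mapping.keys m \<subseteq> X" if m: "m \<in> Poly_Mapping.keys (f * g)" for m
    proof -
      obtain a b where "m = a + b" "a \<in> Poly_Mapping.keys f" "b \<in> Poly_Mapping.keys g"
        using m keys_mult[of f g] by blast
      then show ?thesis using fg Poly_Mapping.keys_add[of a b] by blast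
    qed
    then show ?thesis by simp
  qed
  have neg: "- f \<in> ?C" if "f \<in> ?C" for f
    using that by (auto simp: in_keys_iff)
  have carrier: "carrier (poly_ring X) = ?C" by (simp add: poly_ring_def)
  have ops: "\<And>f g. f \<otimes>\<^bsub>poly_ring X\<^esub> g = f * g" "\<And>f g. f \<oplus>\<^bsub>poly_ring X\<^esub> g = f + g"
    "\<one>\<^bsub>poly_ring X\<^esub> = (1 :: ('v, 'k) mpoly)" "\<zero>\<^bsub>poly_ring X\<^esub> = (0 :: ('v, 'k) mpoly)"
    by (simp_all add: poly_ring_def)
  have zero: "0 \<in> ?C" and one: "1 \<in> ?C" by simp_all
  show ?thesis
  proof (rule cringI)
    show "abelian_group (poly_ring X :: ('v, 'k) mpoly ring)"
    proof (rule abelian_groupI, unfold carrier ops)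
      fix f :: "('v, 'k) mpoly" assume "f \<in> ?C"
      then show "\<exists>g\<in>?C. g + f = 0" using neg[of f] by (intro bexI[of _ "- f"]) simp_all
    next
      fix f g :: "('v, 'k) mpoly" assume "f \<in> ?C" "g \<in> ?C"
      then show "f + g \<in> ?C" by (rule add)
    qed (use zero in \<open>simp_all add: ac_simps\<close>)
    show "comm_monoid (poly_ring X :: ('v, 'k) mpoly ring)"
    proof (rule comm_monoidI, unfold carrier ops)
      fix f g :: "('v, 'k) mpoly" assume "f \<in> ?C" "g \<in> ?C"
      then show "f * g \<in> ?C" by (rule mult)
    qed (use one in \<open>simp_all add: ac_simps\<close>)
  qed (simp add: ops distrib_right)
qed

lemma poly_subst_superset:
  assumes "finite A" "Poly_Mapping.keys f \<subseteq> A"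
  shows "poly_subst g f = (\<Sum>m\<in>A. const (Poly_Mapping.lookup f m) * mono_subst g m)"
  unfolding poly_subst_def
  by (rule sum.mono_neutral_left) (use assms in \<open>auto simp: const_def in_keys_iff\<close>)

lemma poly_subst_add: "poly_subst g (f + h) = poly_subst g f + poly_subst g h"
proof -
  let ?A = "Poly_Mapping.keys f \<union> Poly_Mapping.keys h"
  have "poly_subst g (f + h) = (\<Sum>m\<in>?A. const (Poly_Mapping.lookup (f + h) m) * mono_subst g m)"
    by (rule poly_subst_superset) (use Poly_Mapping.keys_add[of f h] in auto)
  also have "\<dots> = (\<Sum>m\<in>?A. const (Poly_Mapping.lookup f m) * mono_subst g m) +
      (\<Sum>m\<in>?A. const (Poly_Mapping.lookup h m) * mono_subst g m)"
    by (simp add: lookup_add const_def single_add distrib_right sum.distrib)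
  also have "\<dots> = poly_subst g f + poly_subst g h"
    by (simp add: poly_subst_superset[of ?A])
  finally show ?thesis .
qed

lemma poly_subst_sum: "poly_subst g (sum F A) = (\<Sum>a\<in>A. poly_subst g (F a))"
proof -
  have "poly_subst g 0 = 0" by (simp add: poly_subst_def)
  then show ?thesis
    by (induction A rule: infinite_finite_induct) (auto simp: poly_subst_add)
qed

lemma poly_subst_single:
  "poly_subst g (Poly_Mapping.single m c) = const c * mono_subst g m"
  by (simp add: poly_subst_superset[of "{m}"])

lemma poly_subst_const: "poly_subst g (const c) = const c"
  by (simp add: const_def poly_subst_single mono_subst_def)

lemma poly_subst_var: "poly_subst g (var x) = g x"
  by (simp add: var_def poly_subst_single mono_subst_def const_def)

lemma mono_subst_add: "mono_subst g (m + m') = mono_subst g m * mono_subst g m'"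
proof -
  let ?A = "Poly_Mapping.keys m \<union> Poly_Mapping.keys m'"
  have superset: "mono_subst g a = (\<Prod>x\<in>?A. g x ^ Poly_Mapping.lookup a x)" if "Poly_Mapping.keys a \<subseteq> ?A" for a
    unfolding mono_subst_def
    by (rule prod.mono_neutral_left) (use that in \<open>auto simp: in_keys_iff\<close>)
  have "Poly_Mapping.keys (m + m') \<subseteq> ?A" by (rule Poly_Mapping.keys_add)
  then show ?thesis
    by (simp add: superset lookup_add power_add prod.distrib)
qed

lemma sum_single_keys: "(\<Sum>m\<in>Poly_Mapping.keys f. Poly_Mapping.single m (Poly_Mapping.lookup f m)) = f"
  by (rule poly_mapping_eqI)
     (auto simp: lookup_sum lookup_single when_def in_keys_iff)

lemma poly_subst_mult:
  fixes g :: "'v \<Rightarrow> ('w, 'k::comm_ring_1) mpoly"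
  shows "poly_subst g (f * h) = poly_subst g f * poly_subst g h"
proof -
  have "f * h = (\<Sum>m\<in>Poly_Mapping.keys f. Poly_Mapping.single m (Poly_Mapping.lookup f m)) *
      (\<Sum>m\<in>Poly_Mapping.keys h. Poly_Mapping.single m (Poly_Mapping.lookup h m))"
    by (simp only: sum_single_keys)
  also have "\<dots> = (\<Sum>m\<in>Poly_Mapping.keys f. \<Sum>m'\<in>Poly_Mapping.keys h.
      Poly_Mapping.single (m + m') (Poly_Mapping.lookup f m * Poly_Mapping.lookup h m'))"
    by (simp add: sum_product mult_single)
  finally have "poly_subst g (f * h) = (\<Sum>m\<in>Poly_Mapping.keys f. \<Sum>m'\<in>Poly_Mapping.keys h.
      const (Poly_Mapping.lookup f m * Poly_Mapping.lookup h m') * mono_subst g (m + m'))"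
    by (simp add: poly_subst_sum poly_subst_single)
  also have "\<dots> = (\<Sum>m\<in>Poly_Mapping.keys f. \<Sum>m'\<in>Poly_Mapping.keys h.
      (const (Poly_Mapping.lookup f m) * mono_subst g m) * (const (Poly_Mapping.lookup h m') * mono_subst g m'))"
  proof -
    have "const (a * b) = (const a * const b :: ('w, 'k) mpoly)" for a b
      by (simp add: const_def mult_single)
    then show ?thesis by (simp add: mono_subst_add mult_ac)
  qed
  also have "\<dots> = poly_subst g f * poly_subst g h"
    by (simp add: poly_subst_def sum_product)
  finally show ?thesis .
qed

lemma poly_subst_hom:
  fixes g :: "'v \<Rightarrow> ('w, 'k::comm_ring_1) mpoly"
  assumes "\<And>x. x \<in> X \<Longrightarrow> g x \<in> carrier (poly_ring Y)"
  shows "poly_subst g \<in> ring_hom (poly_ring X) (poly_ring Y)"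
proof -
  interpret Y: cring "poly_ring Y :: ('w, 'k) mpoly ring" by (rule poly_ring_cring)
  let ?C = "carrier (poly_ring Y :: ('w, 'k) mpoly ring)"
  have mult: "a * b \<in> ?C" if "a \<in> ?C" "b \<in> ?C" for a b
    using Y.m_closed[OF that] by (simp add: poly_ring_def)
  have add: "a + b \<in> ?C" if "a \<in> ?C" "b \<in> ?C" for a b
    using Y.a_closed[OF that] by (simp add: poly_ring_def)
  have one: "1 \<in> ?C" and zero: "0 \<in> ?C"
    using Y.one_closed Y.zero_closed by (simp_all add: poly_ring_def)
  have power: "a ^ k \<in> ?C" if "a \<in> ?C" for a k
    using that by (induction k) (auto intro: mult one)
  have prod: "prod F A \<in> ?C" if "\<And>a. a \<in> A \<Longrightarrow> F a \<in> ?C" for F and A :: "'v set"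
    using that by (induction A rule: infinite_finite_induct) (auto intro: mult one)
  have sum: "sum F A \<in> ?C" if "\<And>a. a \<in> A \<Longrightarrow> F a \<in> ?C" for F and A :: "('v \<Rightarrow>\<^sub>0 nat) set"
    using that by (induction A rule: infinite_finite_induct) (auto intro: add zero)
  have const: "const c \<in> ?C" for c
    by (simp add: const_def poly_ring_def)
  have "poly_subst g f \<in> ?C" if "f \<in> carrier (poly_ring X)" for f
  proof -
    have "g x \<in> ?C" if "m \<in> Poly_Mapping.keys f" "x \<in> Poly_Mapping.keys m" for m x
      using that \<open>f \<in> carrier (poly_ring X)\<close> assms[of x] by (auto simp: poly_ring_def)
    then show ?thesis
      unfolding poly_subst_def mono_subst_def by (intro sum mult const prod power)
  qed
  moreover have "poly_subst g 1 = 1"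
    using poly_subst_const[of g 1] by (simp add: const_def)
  ultimately show ?thesis
    by (intro ring_hom_memI) (auto simp: poly_ring_def poly_subst_add poly_subst_mult)
qed

end

theory Submission
  imports Defs
begin

text \<open>
  Everything is controlled by one invariant of an edge monomial \<open>m\<close>: its degree together with the
  set of vertices lying on an odd number of edges of \<open>m\<close>. Modulo the differences \<open>x\<^sub>i\<^sup>2 - x\<^sub>j\<^sup>2\<close> a
  vertex monomial is determined by its degree and the parities of its exponents, so \<open>I(G)\<close> consists
  of the polynomials whose coefficients sum to zero over each set of edge monomials with equal
  invariant (\<open>eulerian_ideal_iff\<close>). An ideal generated by binomials that preserve the invariant
  thus equals \<open>I(G)\<close> as soon as it identifies any two monomials with equal invariant
  (\<open>binomial_ideal_iff\<close>).

  For the proposed generators this congruence is shown by induction on the degree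
  (\<open>edge_congruence\<close>). Two monomials with a common variable are reduced to smaller degree by
  cancelling it. The generators \<open>t\<^sub>e\<^sup>2 - t\<^sub>l\<^sup>2\<close> let any square factor be replaced by the square of a
  variable of the other monomial, which creates a common variable. Two squarefree monomials with the
  same invariant are \<open>(T, p)\<close>-joins of the same size. If they are not minimum, both are congruent to
  a smaller join multiplied by a square; if they are minimum and equivalent, a chain of joins with
  pairwise common edges connects them; if they are minimum and inequivalent, the generators
  \<open>t\<^sub>J - t\<^sub>K\<close> connect their classes.

  Minimality uses linear functionals: the sum of the coefficients on a set \<open>A\<close> of monomials vanishes on
  the ideal of the other generators if \<open>A\<close> separates the terms of no monomial multiple of them
  (\<open>coeff_sum_ideal\<close>). For \<open>t\<^sub>e\<^sup>2 - t\<^sub>l\<^sup>2\<close> one takes \<open>A\<close> to consist of \<open>t\<^sub>e\<^sup>2\<close>, and for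
  \<open>t\<^sub>J - t\<^sub>K\<close> one takes the monomials of the equivalence class of \<open>J\<close>. The latter works since a
  nontrivial multiple of a binomial relates only joins that share an edge, hence are equivalent
  (\<open>join_equiv_of_common_factor\<close>).
\<close>

section \<open>Ideals of polynomial rings\<close>

abbreviation monomial :: "('v \<Rightarrow>\<^sub>0 nat) \<Rightarrow> ('v, 'k::comm_ring_1) mpoly" where
  "monomial m \<equiv> Poly_Mapping.single m 1"

lemma poly_ring_carrier:
  "f \<in> carrier (poly_ring X) \<longleftrightarrow> (\<forall>m\<in>Poly_Mapping.keys f. Poly_Mapping.keys m \<subseteq> X)"
  by (simp add: poly_ring_def)

lemma poly_ring_ops:
  "f \<otimes>\<^bsub>poly_ring X\<^esub> g = f * g" "f \<oplus>\<^bsub>poly_ring X\<^esub> g = f + g"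
  "\<one>\<^bsub>poly_ring X\<^esub> = 1" "\<zero>\<^bsub>poly_ring X\<^esub> = 0"
  by (simp_all add: poly_ring_def)

lemma single_in_poly_ring:
  "Poly_Mapping.keys m \<subseteq> X \<Longrightarrow> Poly_Mapping.single m c \<in> carrier (poly_ring X)"
  by (simp add: poly_ring_carrier)

lemma poly_ring_closed:
  fixes f g :: "('v, 'k::comm_ring_1) mpoly"
  assumes "f \<in> carrier (poly_ring X)" "g \<in> carrier (poly_ring X)"
  shows "f + g \<in> carrier (poly_ring X)" "f * g \<in> carrier (poly_ring X)"
    "f - g \<in> carrier (poly_ring X)"
proof -
  interpret cring "poly_ring X :: ('v, 'k) mpoly ring" by (rule poly_ring_cring)
  show add: "f + g \<in> carrier (poly_ring X)" and "f * g \<in> carrier (poly_ring X)"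
    using a_closed[OF assms] m_closed[OF assms] by (simp_all add: poly_ring_ops)
  have "- g \<in> carrier (poly_ring X)"
    using assms(2) by (auto simp: poly_ring_carrier in_keys_iff)
  from a_closed[OF assms(1) this] show "f - g \<in> carrier (poly_ring X)"
    by (simp add: poly_ring_ops)
qed

lemma poly_ring_a_inv:
  fixes f :: "('v, 'k::comm_ring_1) mpoly"
  assumes "f \<in> carrier (poly_ring X)"
  shows "\<ominus>\<^bsub>poly_ring X\<^esub> f = - f"
proof -
  interpret cring "poly_ring X :: ('v, 'k) mpoly ring" by (rule poly_ring_cring)
  have "- f \<in> carrier (poly_ring X)"
    using assms by (auto simp: poly_ring_carrier in_keys_iff)
  then show ?thesis
    using assms by (intro minus_equality) (simp_all add: poly_ring_ops)
qed

lemma poly_ring_idealI: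
  fixes I :: "('v, 'k::comm_ring_1) mpoly set"
  assumes "I \<subseteq> carrier (poly_ring X)" "0 \<in> I"
    and add: "\<And>f g. f \<in> I \<Longrightarrow> g \<in> I \<Longrightarrow> f + g \<in> I"
    and mult: "\<And>f g. f \<in> I \<Longrightarrow> g \<in> carrier (poly_ring X) \<Longrightarrow> g * f \<in> I"
  shows "ideal I (poly_ring X)"
proof -
  interpret cring "poly_ring X :: ('v, 'k) mpoly ring" by (rule poly_ring_cring)
  have "- f \<in> I" if "f \<in> I" for f
    using mult[OF that, of "- 1"] by (simp add: poly_ring_carrier)
  then have "subgroup I (add_monoid (poly_ring X))"
    using assms by (intro add.subgroupI) (auto simp: poly_ring_ops a_inv_def[symmetric] poly_ring_a_inv subset_iff)
  moreover have "f * g \<in> I" if "f \<in> I" "g \<in> carrier (poly_ring X)" for f g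
    using mult[OF that] by (simp add: mult.commute)
  ultimately show ?thesis
    using mult by (intro idealI) (auto simp: poly_ring_ops ring_axioms)
qed

lemma poly_ideal_closed:
  fixes I :: "('v, 'k::comm_ring_1) mpoly set"
  assumes "ideal I (poly_ring X)"
  shows "0 \<in> I"
    and "f \<in> I \<Longrightarrow> g \<in> I \<Longrightarrow> f + g \<in> I"
    and "f \<in> I \<Longrightarrow> - f \<in> I"
    and "f \<in> I \<Longrightarrow> g \<in> carrier (poly_ring X) \<Longrightarrow> g * f \<in> I"
proof -
  interpret ideal I "poly_ring X :: ('v, 'k) mpoly ring" by fact
  show "0 \<in> I" using additive_subgroup.zero_closed[OF is_additive_subgroup] by (simp add: poly_ring_ops)
  show "f \<in> I \<Longrightarrow> g \<in> I \<Longrightarrow> f + g \<in> I" using additive_subgroup.a_closed[OF is_additive_subgroup, of f g] by (simp add: poly_ring_ops)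
  show "f \<in> I \<Longrightarrow> - f \<in> I"
    using additive_subgroup.a_inv_closed[OF is_additive_subgroup, of f]
      poly_ring_a_inv[of f X] a_subset by auto
  show "f \<in> I \<Longrightarrow> g \<in> carrier (poly_ring X) \<Longrightarrow> g * f \<in> I"
    using I_l_closed by (simp add: poly_ring_ops)
qed

lemma poly_ideal_sum:
  assumes "ideal I (poly_ring X)" "\<And>a. a \<in> A \<Longrightarrow> F a \<in> I"
  shows "sum F A \<in> I"
  using assms(2) by (induction A rule: infinite_finite_induct)
    (auto intro: poly_ideal_closed[OF assms(1)])

section \<open>Binomial ideals and sums of coefficients\<close>

definition coeff_sum :: "('v \<Rightarrow>\<^sub>0 nat) set \<Rightarrow> ('v, 'k::comm_ring_1) mpoly \<Rightarrow> 'k" where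
  "coeff_sum A f = (\<Sum>m\<in>Poly_Mapping.keys f. if m \<in> A then Poly_Mapping.lookup f m else 0)"

lemma coeff_sum_superset:
  assumes "finite F" "Poly_Mapping.keys f \<subseteq> F"
  shows "coeff_sum A f = (\<Sum>m\<in>F. if m \<in> A then Poly_Mapping.lookup f m else 0)"
  unfolding coeff_sum_def
  by (rule sum.mono_neutral_left) (use assms in \<open>auto simp: in_keys_iff\<close>)

lemma coeff_sum_single: "coeff_sum A (Poly_Mapping.single m c) = (if m \<in> A then c else 0)"
  by (simp add: coeff_sum_superset[of "{m}"])

lemma coeff_sum_add: "coeff_sum A (f + g) = coeff_sum A f + coeff_sum A g"
proof -
  let ?F = "Poly_Mapping.keys f \<union> Poly_Mapping.keys g"
  have "coeff_sum A (f + g) = (\<Sum>m\<in>?F. if m \<in> A then Poly_Mapping.lookup (f + g) m else 0)"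
    by (rule coeff_sum_superset) (use Poly_Mapping.keys_add[of f g] in auto)
  also have "\<dots> = (\<Sum>m\<in>?F. if m \<in> A then Poly_Mapping.lookup f m else 0) +
      (\<Sum>m\<in>?F. if m \<in> A then Poly_Mapping.lookup g m else 0)"
    by (subst sum.distrib[symmetric]) (auto simp: lookup_add intro!: sum.cong)
  finally show ?thesis
    by (simp add: coeff_sum_superset[of ?F])
qed

lemma coeff_sum_zero: "coeff_sum A 0 = 0"
  by (simp add: coeff_sum_def)

lemma coeff_sum_diff: "coeff_sum A (f - g) = coeff_sum A f - coeff_sum A g"
  using coeff_sum_add[of A "f - g" g] by simp

lemma coeff_sum_sum: "coeff_sum A (sum F S) = (\<Sum>s\<in>S. coeff_sum A (F s))"
  by (induction S rule: infinite_finite_induct) (auto simp: coeff_sum_add coeff_sum_zero)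

lemma coeff_sum_mult:
  "coeff_sum A (g * f) =
     (\<Sum>u\<in>Poly_Mapping.keys g. Poly_Mapping.lookup g u * coeff_sum {m. u + m \<in> A} f)"
proof -
  have "g * f = (\<Sum>u\<in>Poly_Mapping.keys g. Poly_Mapping.single u (Poly_Mapping.lookup g u)) *
      (\<Sum>m\<in>Poly_Mapping.keys f. Poly_Mapping.single m (Poly_Mapping.lookup f m))"
    by (simp only: sum_single_keys)
  also have "\<dots> = (\<Sum>u\<in>Poly_Mapping.keys g. \<Sum>m\<in>Poly_Mapping.keys f.
      Poly_Mapping.single (u + m) (Poly_Mapping.lookup g u * Poly_Mapping.lookup f m))"
    by (simp add: sum_product mult_single)
  finally have "coeff_sum A (g * f) = (\<Sum>u\<in>Poly_Mapping.keys g. \<Sum>m\<in>Poly_Mapping.keys f.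
      if u + m \<in> A then Poly_Mapping.lookup g u * Poly_Mapping.lookup f m else 0)"
    by (simp add: coeff_sum_sum coeff_sum_single)
  then show ?thesis
    by (simp add: coeff_sum_def sum_distrib_left if_distrib cong: if_cong)
qed

text \<open>
  Linear functionals that kill an ideal are the only tool needed to show that a polynomial is
  \<^emph>\<open>not\<close> in it. The sum of the coefficients on \<open>A\<close> kills a binomial times the monomial
  \<open>u\<close> when \<open>A\<close> contains both or neither of the exponents \<open>u + a\<close> and \<open>u + a'\<close> of the product.
\<close>

lemma coeff_sum_ideal:
  fixes B :: "('v, 'k::comm_ring_1) mpoly set"
  assumes B: "\<And>b. b \<in> B \<Longrightarrow> \<exists>a a'. b = monomial a - monomial a' \<and>
      Poly_Mapping.keys a \<subseteq> X \<and> Poly_Mapping.keys a' \<subseteq> X \<and>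
      (\<forall>u. Poly_Mapping.keys u \<subseteq> X \<longrightarrow> (u + a \<in> A \<longleftrightarrow> u + a' \<in> A))"
    and f: "f \<in> Idl\<^bsub>poly_ring X\<^esub> B"
  shows "coeff_sum A f = 0"
proof -
  interpret cring "poly_ring X :: ('v, 'k) mpoly ring" by (rule poly_ring_cring)
  \<comment> \<open>The kernel of one functional need not be an ideal; the polynomials killed by all translates of it
    are one, since multiplication by a monomial translates \<open>A\<close>.\<close>
  define Z :: "('v, 'k) mpoly set" where
    "Z = {f \<in> carrier (poly_ring X).
            \<forall>u. Poly_Mapping.keys u \<subseteq> X \<longrightarrow> coeff_sum {m. u + m \<in> A} f = 0}"
  have mult: "g * f \<in> Z" if f: "f \<in> Z" and g: "g \<in> carrier (poly_ring X)" for f g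
  proof -
    have "coeff_sum {m. u + m \<in> A} (g * f) = 0" if u: "Poly_Mapping.keys u \<subseteq> X" for u
    proof -
      have "coeff_sum {m. u + (v + m) \<in> A} f = 0" if v: "v \<in> Poly_Mapping.keys g" for v
      proof -
        have "Poly_Mapping.keys (u + v) \<subseteq> X"
          using u v g Poly_Mapping.keys_add[of u v] by (auto simp: poly_ring_carrier)
        then have "coeff_sum {m. (u + v) + m \<in> A} f = 0" using f unfolding Z_def by blast
        then show ?thesis by (simp add: add.assoc)
      qed
      then show ?thesis by (simp add: coeff_sum_mult)
    qed
    then show ?thesis using f g by (simp add: Z_def poly_ring_closed)
  qed
  have "ideal Z (poly_ring X)"
    by (rule poly_ring_idealI[OF _ _ _ mult])
       (auto simp: Z_def coeff_sum_add coeff_sum_zero poly_ring_closed poly_ring_carrier[of 0])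
  moreover have "B \<subseteq> Z"
  proof
    fix b assume "b \<in> B"
    then obtain a a' where "b = monomial a - monomial a'" "Poly_Mapping.keys a \<subseteq> X"
        "Poly_Mapping.keys a' \<subseteq> X"
        "\<forall>u. Poly_Mapping.keys u \<subseteq> X \<longrightarrow> (u + a \<in> A \<longleftrightarrow> u + a' \<in> A)"
      using B by blast
    then show "b \<in> Z"
      by (auto simp: Z_def coeff_sum_diff coeff_sum_single poly_ring_closed single_in_poly_ring)
  qed
  ultimately have "f \<in> Z" using genideal_minimal[of Z B] f by auto
  \<comment> \<open>The translate by the monomial 1 is the given functional.\<close>
  then have "Poly_Mapping.keys 0 \<subseteq> X \<longrightarrow> coeff_sum {m. 0 + m \<in> A} f = 0" by (simp add: Z_def del: add_0)
  then show ?thesis by simp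
qed

lemma single_sum: "Poly_Mapping.single m (sum c S) = (\<Sum>s\<in>S. Poly_Mapping.single m (c s))"
  by (induction S rule: infinite_finite_induct) (simp_all add: single_add)

text \<open>
  If the monomials in each fibre of \<open>h\<close> are congruent modulo \<open>I\<close>, a polynomial is congruent to the
  one that concentrates the coefficients of each fibre on a single representative. These collected
  coefficients are the fibre sums, which vanish by assumption.
\<close>

lemma in_ideal_of_coeff_sums:
  fixes f :: "('v, 'k::comm_ring_1) mpoly"
  assumes I: "ideal I (poly_ring X)"
    and f: "f \<in> carrier (poly_ring X)"
    and zero: "\<And>c. coeff_sum (h -` {c}) f = 0"
    and cong: "\<And>m m'. Poly_Mapping.keys m \<subseteq> X \<Longrightarrow> Poly_Mapping.keys m' \<subseteq> X \<Longrightarrow> h m = h m' \<Longrightarrow>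
       monomial m - monomial m' \<in> I"
  shows "f \<in> I"
proof -
  let ?M = "Poly_Mapping.keys f"
  \<comment> \<open>The representative is taken among the monomials of \<open>f\<close>, so that its variables lie in \<open>X\<close>.\<close>
  define r where "r m = (SOME m'. m' \<in> ?M \<and> h m' = h m)" for m
  have r: "r m \<in> ?M \<and> h (r m) = h m" if "m \<in> ?M" for m
    unfolding r_def by (rule someI[of _ m]) (use that in simp)
  have r_h: "r m = r m'" if "h m = h m'" for m m' using that by (simp add: r_def)
  have "(\<Sum>m\<in>?M. Poly_Mapping.single (r m) (Poly_Mapping.lookup f m)) =
      (\<Sum>c\<in>h ` ?M. \<Sum>m\<in>{m \<in> ?M. h m = c}. Poly_Mapping.single (r m) (Poly_Mapping.lookup f m))"
    by (rule sum.image_gen) simp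
  also have "\<dots> = 0"
  proof (rule sum.neutral, rule ballI)
    fix c assume "c \<in> h ` ?M"
    then obtain m0 where m0: "m0 \<in> ?M" "c = h m0" by blast
    have "(\<Sum>m\<in>{m \<in> ?M. h m = c}. Poly_Mapping.single (r m) (Poly_Mapping.lookup f m)) =
        (\<Sum>m\<in>{m \<in> ?M. h m = c}. Poly_Mapping.single (r m0) (Poly_Mapping.lookup f m))"
      using m0(2) by (intro sum.cong refl arg_cong2[where f = Poly_Mapping.single] r_h) simp_all
    also have "\<dots> = Poly_Mapping.single (r m0) (\<Sum>m\<in>{m \<in> ?M. h m = c}. Poly_Mapping.lookup f m)"
      by (simp add: single_sum)
    also have "(\<Sum>m\<in>{m \<in> ?M. h m = c}. Poly_Mapping.lookup f m) = coeff_sum (h -` {c}) f"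
      by (simp add: coeff_sum_def sum.inter_filter)
    finally show "(\<Sum>m\<in>{m \<in> ?M. h m = c}. Poly_Mapping.single (r m) (Poly_Mapping.lookup f m)) = 0"
      using zero by simp
  qed
  finally have "f = (\<Sum>m\<in>?M. Poly_Mapping.single m (Poly_Mapping.lookup f m)) -
      (\<Sum>m\<in>?M. Poly_Mapping.single (r m) (Poly_Mapping.lookup f m))"
    by (simp add: sum_single_keys)
  also have "\<dots> = (\<Sum>m\<in>?M. Poly_Mapping.single 0 (Poly_Mapping.lookup f m) *
      (monomial m - monomial (r m)))"
    by (simp add: right_diff_distrib mult_single sum_subtractf)
  also have "\<dots> \<in> I"
  proof (rule poly_ideal_sum[OF I])
    fix m assume m: "m \<in> ?M"
    have "monomial m - monomial (r m) \<in> I"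
      using r[OF m] m f by (intro cong) (auto simp: poly_ring_carrier)
    then show "Poly_Mapping.single 0 (Poly_Mapping.lookup f m) * (monomial m - monomial (r m)) \<in> I"
      by (rule poly_ideal_closed(4)[OF I]) (simp add: single_in_poly_ring)
  qed
  finally show ?thesis .
qed

text \<open>
  Both ideals of interest, the one generated by the differences \<open>x\<^sub>i\<^sup>2 - x\<^sub>j\<^sup>2\<close> and the Eulerian
  ideal, are of this kind: an ideal that identifies precisely the monomials with the same invariant
  \<open>h\<close> is the common kernel of the fibre sums of \<open>h\<close>.
\<close>

lemma binomial_ideal_iff:
  fixes B :: "('v, 'k::comm_ring_1) mpoly set"
  assumes B: "\<And>b. b \<in> B \<Longrightarrow> \<exists>a a'. b = monomial a - monomial a' \<and>
      Poly_Mapping.keys a \<subseteq> X \<and> Poly_Mapping.keys a' \<subseteq> X \<and> h a = h a'"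
    and h: "\<And>u a a'. h a = h a' \<Longrightarrow> h (u + a) = h (u + a')"
    and cong: "\<And>m m'. Poly_Mapping.keys m \<subseteq> X \<Longrightarrow> Poly_Mapping.keys m' \<subseteq> X \<Longrightarrow> h m = h m' \<Longrightarrow>
       monomial m - monomial m' \<in> Idl\<^bsub>poly_ring X\<^esub> B"
  shows "f \<in> Idl\<^bsub>poly_ring X\<^esub> B \<longleftrightarrow>
    f \<in> carrier (poly_ring X) \<and> (\<forall>c. coeff_sum (h -` {c}) f = 0)"
proof -
  interpret cring "poly_ring X :: ('v, 'k) mpoly ring" by (rule poly_ring_cring)
  have "B \<subseteq> carrier (poly_ring X)"
    using B by (fastforce intro: poly_ring_closed single_in_poly_ring)
  then have I: "ideal (Idl\<^bsub>poly_ring X\<^esub> B) (poly_ring X)" by (rule genideal_ideal)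
  show ?thesis
  proof
    assume f: "f \<in> Idl\<^bsub>poly_ring X\<^esub> B"
    have "coeff_sum (h -` {c}) f = 0" for c
    proof (rule coeff_sum_ideal[OF _ f])
      fix b assume "b \<in> B"
      then obtain a a' where a: "b = monomial a - monomial a'" "Poly_Mapping.keys a \<subseteq> X"
          "Poly_Mapping.keys a' \<subseteq> X" "h a = h a'"
        using B by blast
      then show "\<exists>a a'. b = monomial a - monomial a' \<and>
          Poly_Mapping.keys a \<subseteq> X \<and> Poly_Mapping.keys a' \<subseteq> X \<and>
          (\<forall>u. Poly_Mapping.keys u \<subseteq> X \<longrightarrow> (u + a \<in> h -` {c} \<longleftrightarrow> u + a' \<in> h -` {c}))"
        using h[OF a(4)] by (intro exI[of _ a] exI[of _ a']) simp
    qed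
    then show "f \<in> carrier (poly_ring X) \<and> (\<forall>c. coeff_sum (h -` {c}) f = 0)"
      using f additive_subgroup.a_subset[OF ideal.axioms(1)[OF I]] by blast
  next
    assume "f \<in> carrier (poly_ring X) \<and> (\<forall>c. coeff_sum (h -` {c}) f = 0)"
    then show "f \<in> Idl\<^bsub>poly_ring X\<^esub> B"
      by (intro in_ideal_of_coeff_sums[OF I, of f h] cong) simp_all
  qed
qed

section \<open>Monomials and their signatures\<close>

lemma var_power: "var x ^ k = monomial (Poly_Mapping.single x k)"
  by (induction k) (simp_all add: var_def mult_single single_add[symmetric])

lemma monomial_sum:
  "(monomial (sum F A) :: ('v, 'k::comm_ring_1) mpoly) = (\<Prod>a\<in>A. monomial (F a))"
proof (induction A rule: infinite_finite_induct)
  case (insert x A)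
  then show ?case using mult_single[of "F x" "1::'k" "sum F A" 1] by simp
qed simp_all

lemma mono_degree_superset:
  assumes "finite A" "Poly_Mapping.keys m \<subseteq> A"
  shows "mono_degree m = (\<Sum>x\<in>A. Poly_Mapping.lookup m x)"
  unfolding mono_degree_def
  by (rule sum.mono_neutral_left) (use assms in \<open>auto simp: in_keys_iff\<close>)

lemma mono_degree_add: "mono_degree (a + b) = mono_degree a + mono_degree b"
proof -
  let ?A = "Poly_Mapping.keys a \<union> Poly_Mapping.keys b"
  have "mono_degree (a + b) = (\<Sum>x\<in>?A. Poly_Mapping.lookup (a + b) x)"
    by (rule mono_degree_superset) (use Poly_Mapping.keys_add[of a b] in auto)
  then show ?thesis
    by (simp add: mono_degree_superset[of ?A] lookup_add sum.distrib)
qed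

lemma mono_degree_single: "mono_degree (Poly_Mapping.single x k) = k"
  by (simp add: mono_degree_superset[of "{x}"])

lemma mono_degree_sum: "mono_degree (sum F A) = (\<Sum>a\<in>A. mono_degree (F a))"
  by (induction A rule: infinite_finite_induct) (simp_all add: mono_degree_add, simp_all add: mono_degree_def)

lemma mono_degree_eq_0: "mono_degree m = 0 \<longleftrightarrow> m = 0"
proof
  assume "mono_degree m = 0"
  then show "m = 0" unfolding mono_degree_def
    by (metis finite_keys in_keys_iff keys_eq_empty sum_eq_0_iff equals0I)
qed (simp add: mono_degree_def)

lemma lookup_le_mono_degree: "Poly_Mapping.lookup m x \<le> mono_degree m"
  by (cases "x \<in> Poly_Mapping.keys m")
     (auto simp: mono_degree_def in_keys_iff intro: member_le_sum)

lemma split_variable: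
  fixes m :: "'v \<Rightarrow>\<^sub>0 nat"
  assumes "k \<le> Poly_Mapping.lookup m x"
  obtains r where "m = Poly_Mapping.single x k + r" "Poly_Mapping.keys r \<subseteq> Poly_Mapping.keys m"
proof
  show "m = Poly_Mapping.single x k + (m - Poly_Mapping.single x k)"
    using assms by (intro poly_mapping_eqI) (auto simp: lookup_add lookup_minus lookup_single when_def)
  show "Poly_Mapping.keys (m - Poly_Mapping.single x k) \<subseteq> Poly_Mapping.keys m"
    by (auto simp: in_keys_iff lookup_minus)
qed

text \<open>
  The squares of all variables are identified, so a monomial is reduced to its total degree and the
  parities of its exponents.
\<close>

definition odd_support :: "('v \<Rightarrow>\<^sub>0 nat) \<Rightarrow> 'v set" where
  "odd_support m = {x. odd (Poly_Mapping.lookup m x)}"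

definition signature :: "('v \<Rightarrow>\<^sub>0 nat) \<Rightarrow> nat \<times> 'v set" where
  "signature m = (mono_degree m, odd_support m)"

lemma signature_add_cancel: "signature (u + a) = signature (u + a') \<longleftrightarrow> signature a = signature a'"
  by (auto simp: signature_def odd_support_def mono_degree_add lookup_add set_eq_iff)

section \<open>Congruence modulo an ideal containing differences of squares\<close>

definition monomial_cong ::
    "('v, 'k::comm_ring_1) mpoly set \<Rightarrow> ('v \<Rightarrow>\<^sub>0 nat) \<Rightarrow> ('v \<Rightarrow>\<^sub>0 nat) \<Rightarrow> bool" where
  "monomial_cong I m m' \<longleftrightarrow> monomial m - monomial m' \<in> I"

text \<open>
  An ideal that identifies the squares of all variables of \<open>X\<close>, together with an invariant \<open>h\<close> of
  monomials that is compatible with this identification. The locale is used twice: for the vertex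
  variables with \<open>signature\<close>, and for the edge variables with \<open>edge_signature\<close>. Its two main
  lemmas are the steps of an induction on the degree showing that \<open>h\<close> decides congruence modulo \<open>I\<close>.
\<close>

locale square_congruence =
  fixes X :: "'v set" and I :: "('v, 'k::comm_ring_1) mpoly set"
    and h :: "('v \<Rightarrow>\<^sub>0 nat) \<Rightarrow> 'c"
  assumes ideal: "ideal I (poly_ring X)"
    and squares: "\<And>x y. x \<in> X \<Longrightarrow> y \<in> X \<Longrightarrow>
      monomial_cong I (Poly_Mapping.single x 2) (Poly_Mapping.single y 2)"
    and h_cancel: "\<And>u a a'. h (u + a) = h (u + a') \<longleftrightarrow> h a = h a'"
    and h_square: "\<And>x y. x \<in> X \<Longrightarrow> y \<in> X \<Longrightarrow> h (Poly_Mapping.single x 2) = h (Poly_Mapping.single y 2)"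
    and h_degree: "\<And>m m'. Poly_Mapping.keys m \<subseteq> X \<Longrightarrow> Poly_Mapping.keys m' \<subseteq> X \<Longrightarrow> h m = h m' \<Longrightarrow>
      mono_degree m = mono_degree m'"
begin

lemma cong_refl: "monomial_cong I m m"
  using poly_ideal_closed(1)[OF ideal] by (simp add: monomial_cong_def)

lemma cong_sym: "monomial_cong I m m' \<Longrightarrow> monomial_cong I m' m"
  using poly_ideal_closed(3)[OF ideal] by (force simp: monomial_cong_def)

lemma cong_trans: "monomial_cong I a b \<Longrightarrow> monomial_cong I b c \<Longrightarrow> monomial_cong I a c"
  using poly_ideal_closed(2)[OF ideal, of "monomial a - monomial b" "monomial b - monomial c"]
  by (simp add: monomial_cong_def)

lemma cong_add:
  assumes "monomial_cong I a b" "Poly_Mapping.keys u \<subseteq> X"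
  shows "monomial_cong I (u + a) (u + b)"
  using poly_ideal_closed(4)[OF ideal, of "monomial a - monomial b" "monomial u"] assms
  by (simp add: monomial_cong_def single_in_poly_ring right_diff_distrib mult_single)

text \<open>
  A common variable can be cancelled, which lowers the degree and, by additivity of the invariant,
  keeps the two values of \<open>h\<close> equal.
\<close>

lemma cong_of_common_variable:
  assumes IH: "\<And>a b. Poly_Mapping.keys a \<subseteq> X \<Longrightarrow> Poly_Mapping.keys b \<subseteq> X \<Longrightarrow> h a = h b \<Longrightarrow>
      mono_degree a < mono_degree m \<Longrightarrow> monomial_cong I a b"
    and m: "Poly_Mapping.keys m \<subseteq> X" "Poly_Mapping.keys m' \<subseteq> X" "h m = h m'"
    and x: "x \<in> Poly_Mapping.keys m" "x \<in> Poly_Mapping.keys m'"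
  shows "monomial_cong I m m'"
proof -
  obtain r where r: "m = Poly_Mapping.single x 1 + r" "Poly_Mapping.keys r \<subseteq> Poly_Mapping.keys m"
    using x split_variable[of 1 m x] by (auto simp: in_keys_iff)
  obtain r' where r': "m' = Poly_Mapping.single x 1 + r'" "Poly_Mapping.keys r' \<subseteq> Poly_Mapping.keys m'"
    using x split_variable[of 1 m' x] by (auto simp: in_keys_iff)
  have "h r = h r'" using m(3) unfolding r(1) r'(1) h_cancel .
  moreover have "mono_degree r < mono_degree m"
    by (simp add: r(1) mono_degree_add mono_degree_single)
  ultimately have "monomial_cong I r r'" using IH r r' m by blast
  then have "monomial_cong I (Poly_Mapping.single x 1 + r) (Poly_Mapping.single x 1 + r')"
    using x m by (intro cong_add) auto
  then show ?thesis by (simp only: r(1)[symmetric] r'(1)[symmetric])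
qed

text \<open>
  A square \<open>x\<^sup>2\<close> dividing \<open>m\<close> may be traded for \<open>y\<^sup>2\<close> with any variable \<open>y\<close> of \<open>m'\<close>, after which
  the two monomials have the variable \<open>y\<close> in common.
\<close>

lemma cong_of_square_factor:
  assumes IH: "\<And>a b. Poly_Mapping.keys a \<subseteq> X \<Longrightarrow> Poly_Mapping.keys b \<subseteq> X \<Longrightarrow> h a = h b \<Longrightarrow>
      mono_degree a < mono_degree m \<Longrightarrow> monomial_cong I a b"
    and m: "Poly_Mapping.keys m \<subseteq> X" "Poly_Mapping.keys m' \<subseteq> X" "h m = h m'"
    and x: "2 \<le> Poly_Mapping.lookup m x"
  shows "monomial_cong I m m'"
proof -
  have "mono_degree m' \<noteq> 0"
    using h_degree[OF m] lookup_le_mono_degree[of m x] x by linarith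
  then obtain y where y: "y \<in> Poly_Mapping.keys m'"
    by (metis all_not_in_conv keys_eq_empty mono_degree_eq_0)
  have xX: "x \<in> X" using x m(1) by (auto simp: in_keys_iff subset_iff)
  have yX: "y \<in> X" using y m(2) by auto
  obtain r where r: "m = Poly_Mapping.single x 2 + r" "Poly_Mapping.keys r \<subseteq> Poly_Mapping.keys m"
    using x split_variable[of 2 m x] by blast
  define s where "s = Poly_Mapping.single y 2 + r"
  have rX: "Poly_Mapping.keys r \<subseteq> X" using r(2) m(1) by blast
  have sX: "Poly_Mapping.keys s \<subseteq> X"
    using rX yX Poly_Mapping.keys_add[of "Poly_Mapping.single y 2" r] by (auto simp: s_def split: if_splits)
  have ms: "monomial_cong I m s"
    using cong_add[OF squares[OF xX yX] rX] by (simp add: r(1) s_def add.commute)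
  have hms: "h m = h s"
    using h_square[OF xX yX] h_cancel[of r "Poly_Mapping.single x 2" "Poly_Mapping.single y 2"]
    by (simp add: r(1) s_def add.commute)
  have "y \<in> Poly_Mapping.keys s" by (simp add: s_def in_keys_iff lookup_add)
  moreover have "mono_degree s = mono_degree m" using h_degree[OF m(1) sX hms] by simp
  ultimately have "monomial_cong I s m'"
    using IH sX m y hms by (intro cong_of_common_variable[of s m' y]) auto
  with ms show ?thesis by (rule cong_trans)
qed

end

text \<open>
  Distinct monomials of the same degree and parities must differ at some variable whose exponent is
  larger in \<open>m\<close>; equality of parities makes it larger by at least 2, so that \<open>m\<close> has a square factor.
\<close>

lemma vertex_congruence:
  fixes I :: "('v, 'k::comm_ring_1) mpoly set"
  assumes "square_congruence X I signature"
    and "Poly_Mapping.keys m \<subseteq> X" "Poly_Mapping.keys m' \<subseteq> X" "signature m = signature m'"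
  shows "monomial_cong I m m'"
proof -
  interpret square_congruence X I signature by fact
  show ?thesis using assms(2-)
  proof (induction "mono_degree m" arbitrary: m m' rule: less_induct)
    case less
    show ?case
    proof (cases "m = m'")
      case True
      then show ?thesis by (simp add: cong_refl)
    next
      case False
      have eq: "mono_degree m = mono_degree m'" "odd_support m = odd_support m'"
        using less.prems(3) by (auto simp: signature_def)
      have "\<exists>x. Poly_Mapping.lookup m' x < Poly_Mapping.lookup m x"
      proof (rule ccontr)
        assume "\<not> ?thesis"
        then have le: "\<And>x. Poly_Mapping.lookup m x \<le> Poly_Mapping.lookup m' x" by (simp add: not_less)
        have "mono_degree (m' - m) + mono_degree m = mono_degree m'"
          using le by (subst mono_degree_add[symmetric]) (auto intro!: arg_cong[of _ _ mono_degree] poly_mapping_eqI simp: lookup_add lookup_minus)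
        then have "m' - m = 0" using eq by (simp add: mono_degree_eq_0)
        then have "\<And>x. Poly_Mapping.lookup m' x - Poly_Mapping.lookup m x = 0"
          by (metis lookup_minus lookup_zero)
        then have "m = m'" using le by (intro poly_mapping_eqI) (simp add: antisym)
        with False show False ..
      qed
      then obtain x where x: "Poly_Mapping.lookup m' x < Poly_Mapping.lookup m x" ..
      have "odd (Poly_Mapping.lookup m x) \<longleftrightarrow> odd (Poly_Mapping.lookup m' x)"
        using eq(2) by (auto simp: odd_support_def)
      with x have "2 \<le> Poly_Mapping.lookup m x" by presburger
      then show ?thesis
        using less by (intro cong_of_square_factor[of m m' x]) auto
    qed
  qed
qed

section \<open>Coefficient sums describing the Eulerian ideal\<close>

text \<open>
  The effect of \<open>t\<^sub>e \<mapsto> x\<^sub>i x\<^sub>j\<close> on exponent vectors.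
\<close>

definition vertex_monomial :: "('a set \<Rightarrow>\<^sub>0 nat) \<Rightarrow> ('a \<Rightarrow>\<^sub>0 nat)" where
  "vertex_monomial m = (\<Sum>e\<in>Poly_Mapping.keys m. \<Sum>i\<in>e. Poly_Mapping.single i (Poly_Mapping.lookup m e))"

lemma vertex_monomial_superset:
  assumes "finite A" "Poly_Mapping.keys m \<subseteq> A"
  shows "vertex_monomial m = (\<Sum>e\<in>A. \<Sum>i\<in>e. Poly_Mapping.single i (Poly_Mapping.lookup m e))"
  unfolding vertex_monomial_def
  by (rule sum.mono_neutral_left) (use assms in \<open>auto simp: in_keys_iff\<close>)

lemma vertex_monomial_add: "vertex_monomial (a + b) = vertex_monomial a + vertex_monomial b"
proof -
  let ?A = "Poly_Mapping.keys a \<union> Poly_Mapping.keys b"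
  have "vertex_monomial (a + b) = (\<Sum>e\<in>?A. \<Sum>i\<in>e. Poly_Mapping.single i (Poly_Mapping.lookup (a + b) e))"
    by (rule vertex_monomial_superset) (use Poly_Mapping.keys_add[of a b] in auto)
  then show ?thesis
    by (simp add: vertex_monomial_superset[of ?A] lookup_add single_add sum.distrib)
qed

lemma vertex_monomial_single: "vertex_monomial (Poly_Mapping.single e k) = (\<Sum>i\<in>e. Poly_Mapping.single i k)"
  by (simp add: vertex_monomial_superset[of "{e}"])

lemma edge_map_eq:
  fixes f :: "('a set, 'k::comm_ring_1) mpoly"
  shows "edge_map f = (\<Sum>m\<in>Poly_Mapping.keys f. Poly_Mapping.single (vertex_monomial m) (Poly_Mapping.lookup f m))"
proof -
  have "mono_subst (prod var) m = (monomial (vertex_monomial m) :: ('a, 'k) mpoly)" for m :: "'a set \<Rightarrow>\<^sub>0 nat"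
    by (simp add: mono_subst_def vertex_monomial_def monomial_sum prod_power_distrib var_power)
  then show ?thesis
    by (simp add: edge_map_def poly_subst_def const_def mult_single)
qed

lemma coeff_sum_edge_map: "coeff_sum A (edge_map f) = coeff_sum (vertex_monomial -` A) f"
  unfolding edge_map_eq coeff_sum_sum coeff_sum_single by (simp add: coeff_sum_def)

text \<open>
  For an edge monomial the second component is the set of vertices that lie on an odd number of its
  edges (with multiplicity), and the first is twice its degree. For the squarefree monomial of a
  set \<open>J\<close> of edges it therefore records the set \<open>T\<close> for which \<open>J\<close> is a join, and \<open>card J\<close>.
\<close>

definition edge_signature :: "('a set \<Rightarrow>\<^sub>0 nat) \<Rightarrow> nat \<times> 'a set" where
  "edge_signature m = signature (vertex_monomial m)"

lemma edge_signature_add_cancel: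
  "edge_signature (u + a) = edge_signature (u + a') \<longleftrightarrow> edge_signature a = edge_signature a'"
  by (simp add: edge_signature_def vertex_monomial_add signature_add_cancel)

lemma simple_graph_edge:
  assumes "simple_graph V E" "e \<in> E"
  shows "e \<subseteq> V" "card e = 2" "finite e"
  using assms by (auto simp: simple_graph_def intro: finite_subset)

lemma in_keys_sum:
  assumes "k \<in> Poly_Mapping.keys (sum F A)"
  obtains a where "a \<in> A" "k \<in> Poly_Mapping.keys (F a)"
  using assms Poly_Mapping.keys_sum[of F A] by blast

lemma keys_vertex_monomial:
  assumes "simple_graph V E" "Poly_Mapping.keys m \<subseteq> E"
  shows "Poly_Mapping.keys (vertex_monomial m) \<subseteq> V"
proof
  fix i assume "i \<in> Poly_Mapping.keys (vertex_monomial m)"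
  then obtain e where "e \<in> Poly_Mapping.keys m"
      "i \<in> Poly_Mapping.keys (\<Sum>i\<in>e. Poly_Mapping.single i (Poly_Mapping.lookup m e))"
    unfolding vertex_monomial_def by (rule in_keys_sum)
  moreover from this obtain j where "j \<in> e" "i \<in> Poly_Mapping.keys (Poly_Mapping.single j (Poly_Mapping.lookup m e))"
    by (elim in_keys_sum)
  ultimately show "i \<in> V" using assms simple_graph_edge(1)[OF assms(1)] by (auto split: if_splits)
qed

lemma mono_degree_vertex_monomial:
  assumes "simple_graph V E" "Poly_Mapping.keys m \<subseteq> E"
  shows "mono_degree (vertex_monomial m) = 2 * mono_degree m"
proof -
  have "mono_degree (vertex_monomial m) = (\<Sum>e\<in>Poly_Mapping.keys m. 2 * Poly_Mapping.lookup m e)"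
    unfolding vertex_monomial_def mono_degree_sum mono_degree_single
    using simple_graph_edge(2)[OF assms(1)] assms(2) by (intro sum.cong) auto
  then show ?thesis by (simp add: mono_degree_def sum_distrib_left)
qed

lemma edge_signature_square:
  assumes "simple_graph V E" "e \<in> E"
  shows "edge_signature (Poly_Mapping.single e 2) = (4, {})"
proof -
  have "odd_support (\<Sum>i\<in>A. Poly_Mapping.single i (2::nat)) = {}" for A :: "'a set"
    by (simp add: odd_support_def lookup_sum lookup_single when_def if_distrib dvd_sum)
  then show ?thesis
    using simple_graph_edge[OF assms]
    by (simp add: edge_signature_def signature_def vertex_monomial_single mono_degree_sum mono_degree_single)
qed

lemma edge_signature_degree:
  assumes "simple_graph V E" "Poly_Mapping.keys m \<subseteq> E" "Poly_Mapping.keys m' \<subseteq> E"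
    and "edge_signature m = edge_signature m'"
  shows "mono_degree m = mono_degree m'"
  using assms by (simp add: edge_signature_def signature_def mono_degree_vertex_monomial)

text \<open>
  A difference \<open>x\<^sub>i\<^sup>2 - x\<^sub>j\<^sup>2\<close> preserves the signature, and conversely equal signatures imply
  congruence, so membership of the image in the ideal of squares is decided by fibre sums. Since
  \<open>edge_map\<close> sends monomials to monomials and keeps their coefficients, these sums
  pull back to fibre sums of \<open>edge_signature\<close>.
\<close>

lemma eulerian_ideal_iff:
  fixes f :: "('a set, 'k::comm_ring_1) mpoly"
  assumes G: "simple_graph V E"
  shows "f \<in> eulerian_ideal V E \<longleftrightarrow>
    f \<in> carrier (poly_ring E) \<and> (\<forall>c. coeff_sum (edge_signature -` {c}) f = 0)"
proof -
  let ?Q = "{(var i)\<^sup>2 - (var j)\<^sup>2 | i j. i \<in> V \<and> j \<in> V} :: ('a, 'k) mpoly set"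
  interpret cring "poly_ring V :: ('a, 'k) mpoly ring" by (rule poly_ring_cring)
  have Q_carrier: "?Q \<subseteq> carrier (poly_ring V)"
    by (auto simp: var_power intro!: poly_ring_closed single_in_poly_ring)
  have ideal: "ideal (Idl\<^bsub>poly_ring V\<^esub> ?Q) (poly_ring V)"
    by (rule genideal_ideal[OF Q_carrier])
  have sq: "square_congruence V (Idl\<^bsub>poly_ring V\<^esub> ?Q) signature"
  proof (rule square_congruence.intro[OF ideal])
    fix i j assume "i \<in> V" "j \<in> V"
    then have "(var i)\<^sup>2 - (var j)\<^sup>2 \<in> Idl\<^bsub>poly_ring V\<^esub> ?Q"
      using genideal_self[OF Q_carrier] by blast
    then show "monomial_cong (Idl\<^bsub>poly_ring V\<^esub> ?Q) (Poly_Mapping.single i 2) (Poly_Mapping.single j 2)"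
      by (simp add: monomial_cong_def var_power)
  next
    fix i j assume "i \<in> V" "j \<in> V"
    show "signature (Poly_Mapping.single i 2) = signature (Poly_Mapping.single j 2)"
      by (simp add: signature_def mono_degree_single odd_support_def lookup_single when_def)
  next
    show "mono_degree m = mono_degree m'" if "signature m = signature m'" for m m' :: "'a \<Rightarrow>\<^sub>0 nat"
      using that by (simp add: signature_def)
  qed (rule signature_add_cancel)
  have mem: "edge_map f \<in> Idl\<^bsub>poly_ring V\<^esub> ?Q \<longleftrightarrow>
      edge_map f \<in> carrier (poly_ring V) \<and> (\<forall>c. coeff_sum (signature -` {c}) (edge_map f) = 0)"
  proof (rule binomial_ideal_iff)
    fix b assume "b \<in> ?Q"
    then obtain i j where "i \<in> V" "j \<in> V" "b = (var i)\<^sup>2 - (var j)\<^sup>2" by blast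
    then show "\<exists>a a'. b = monomial a - monomial a' \<and> Poly_Mapping.keys a \<subseteq> V \<and>
        Poly_Mapping.keys a' \<subseteq> V \<and> signature a = signature a'"
      using square_congruence.h_square[OF sq, of i j]
      by (intro exI[of _ "Poly_Mapping.single i 2"] exI[of _ "Poly_Mapping.single j 2"])
         (simp add: var_power)
  next
    fix u a a' :: "'a \<Rightarrow>\<^sub>0 nat" assume "signature a = signature a'"
    then show "signature (u + a) = signature (u + a')" by (simp only: signature_add_cancel)
  next
    fix m m' :: "'a \<Rightarrow>\<^sub>0 nat"
    assume "Poly_Mapping.keys m \<subseteq> V" "Poly_Mapping.keys m' \<subseteq> V" "signature m = signature m'"
    then show "monomial m - monomial m' \<in> Idl\<^bsub>poly_ring V\<^esub> ?Q"
      using vertex_congruence[OF sq, of m m'] by (simp only: monomial_cong_def)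
  qed
  have closed: "edge_map f \<in> carrier (poly_ring V)" if "f \<in> carrier (poly_ring E)"
  proof -
    have "Poly_Mapping.keys k \<subseteq> V" if k: "k \<in> Poly_Mapping.keys (edge_map f)" for k
    proof -
      obtain m where "m \<in> Poly_Mapping.keys f"
          "k \<in> Poly_Mapping.keys (Poly_Mapping.single (vertex_monomial m) (Poly_Mapping.lookup f m))"
        using k unfolding edge_map_eq by (rule in_keys_sum)
      then show ?thesis
        using keys_vertex_monomial[OF G, of m] \<open>f \<in> carrier (poly_ring E)\<close>
        by (auto simp: poly_ring_carrier split: if_splits)
    qed
    then show ?thesis by (simp add: poly_ring_carrier)
  qed
  have sums: "coeff_sum (signature -` A) (edge_map f) = coeff_sum (edge_signature -` A) f"
    for A :: "(nat \<times> 'a set) set"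
    by (simp only: coeff_sum_edge_map vimage_def edge_signature_def mem_Collect_eq)
  show ?thesis
    using closed by (simp only: eulerian_ideal_def mem_Collect_eq mem sums) blast
qed

section \<open>Joins as squarefree monomials\<close>

definition indicator_monomial :: "'v set \<Rightarrow> ('v \<Rightarrow>\<^sub>0 nat)" where
  "indicator_monomial J = (\<Sum>e\<in>J. Poly_Mapping.single e 1)"

lemma edge_monom_eq: "edge_monom J = monomial (indicator_monomial J)"
  unfolding edge_monom_def indicator_monomial_def monomial_sum var_def ..

lemma lookup_indicator_monomial:
  "finite J \<Longrightarrow> Poly_Mapping.lookup (indicator_monomial J) e = (if e \<in> J then 1 else 0)"
  by (simp add: indicator_monomial_def lookup_sum lookup_single when_def)

lemma keys_indicator_monomial: "finite J \<Longrightarrow> Poly_Mapping.keys (indicator_monomial J) = J"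
  by (auto simp: in_keys_iff lookup_indicator_monomial split: if_splits)

lemma mono_degree_indicator_monomial: "mono_degree (indicator_monomial J) = card J"
  by (simp add: indicator_monomial_def mono_degree_sum mono_degree_single)

lemma indicator_monomial_of_keys:
  assumes "\<And>e. Poly_Mapping.lookup m e < 2"
  shows "m = indicator_monomial (Poly_Mapping.keys m)"
proof (rule poly_mapping_eqI)
  fix e
  show "Poly_Mapping.lookup m e = Poly_Mapping.lookup (indicator_monomial (Poly_Mapping.keys m)) e"
    using assms[of e] by (auto simp: lookup_indicator_monomial in_keys_iff)
qed

lemma finite_edges: "simple_graph V E \<Longrightarrow> finite E"
  unfolding simple_graph_def by (rule finite_subset[of _ "Pow V"]) auto

lemma odd_support_indicator_monomial:
  assumes G: "simple_graph V E" and J: "J \<subseteq> E"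
  shows "odd_support (vertex_monomial (indicator_monomial J)) = {v \<in> V. odd (deg J v)}"
proof -
  have fin: "finite J" using finite_subset[OF J finite_edges[OF G]] .
  have "Poly_Mapping.lookup (vertex_monomial (indicator_monomial J)) v = deg J v" for v
  proof -
    have "Poly_Mapping.lookup (vertex_monomial (indicator_monomial J)) v =
        (\<Sum>e\<in>J. Poly_Mapping.lookup (\<Sum>i\<in>e. Poly_Mapping.single i (1::nat)) v)"
      using fin by (simp add: vertex_monomial_superset[of J] keys_indicator_monomial
          lookup_indicator_monomial lookup_sum)
    also have "\<dots> = (\<Sum>e\<in>J. if v \<in> e then 1 else 0)"
      using simple_graph_edge(3)[OF G] J
      by (intro sum.cong refl) (auto simp: lookup_sum lookup_single when_def)
    also have "\<dots> = deg J v"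
      using fin by (simp add: deg_def sum.inter_filter[symmetric])
    finally show ?thesis .
  qed
  moreover have "deg J v = 0" if "v \<notin> V" for v
  proof -
    have "{e \<in> J. v \<in> e} = {}" using that simple_graph_edge(1)[OF G] J by blast
    then show ?thesis unfolding deg_def by (simp only: card.empty)
  qed
  ultimately show ?thesis unfolding odd_support_def by (intro Collect_cong) fastforce
qed

lemma joins_iff:
  assumes "simple_graph V E"
  shows "J \<in> joins V E T p \<longleftrightarrow>
    J \<subseteq> E \<and> odd_support (vertex_monomial (indicator_monomial J)) = T \<and> of_nat (card J) = p"
proof (cases "J \<subseteq> E")
  case True
  show ?thesis
    unfolding joins_def mem_Collect_eq odd_support_indicator_monomial[OF assms True] by blast
qed (simp add: joins_def)

lemma of_nat_bit_eq_iff: "(of_nat a :: bit) = of_nat b \<longleftrightarrow> (even a \<longleftrightarrow> even b)"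
  by (simp only: Z2.bit_eq_iff even_of_nat)

lemma edge_signature_eq_iff:
  assumes "simple_graph V E" "Poly_Mapping.keys m \<subseteq> E" "Poly_Mapping.keys m' \<subseteq> E"
  shows "edge_signature m = edge_signature m' \<longleftrightarrow>
    mono_degree m = mono_degree m' \<and> odd_support (vertex_monomial m) = odd_support (vertex_monomial m')"
  using assms by (simp add: edge_signature_def signature_def mono_degree_vertex_monomial)

lemma odd_support_add_double: "odd_support (vertex_monomial (a + (b + b))) = odd_support (vertex_monomial a)"
  by (simp add: odd_support_def vertex_monomial_add lookup_add)

lemma odd_support_subset_keys: "odd_support m \<subseteq> Poly_Mapping.keys m"
proof
  fix x assume "x \<in> odd_support m"
  then have "Poly_Mapping.lookup m x \<noteq> 0" by (auto simp: odd_support_def elim: oddE)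
  then show "x \<in> Poly_Mapping.keys m" by (simp add: in_keys_iff)
qed

lemma squarefree_part:
  "\<exists>r. m = indicator_monomial (odd_support m) + (r + r)"
proof (rule exI[of _ "Poly_Mapping.map (\<lambda>k. k div 2) m"], rule poly_mapping_eqI)
  fix e
  have fin: "finite (odd_support m)"
    by (rule finite_subset[OF odd_support_subset_keys]) simp
  have half: "Poly_Mapping.lookup (Poly_Mapping.map (\<lambda>k. k div 2) m) e = Poly_Mapping.lookup m e div 2"
    by (simp add: Poly_Mapping.map.rep_eq when_def)
  show "Poly_Mapping.lookup m e = Poly_Mapping.lookup (indicator_monomial (odd_support m) +
      (Poly_Mapping.map (\<lambda>k. k div 2) m + Poly_Mapping.map (\<lambda>k. k div 2) m)) e"
    unfolding lookup_add half lookup_indicator_monomial[OF fin]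
    by (simp add: odd_support_def) presburger
qed

lemma min_joins_subset: "J \<in> min_joins V E T p \<Longrightarrow> J \<subseteq> E"
  by (simp add: min_joins_def joins_def)

lemma min_joins_finite: "simple_graph V E \<Longrightarrow> J \<in> min_joins V E T p \<Longrightarrow> finite J"
  by (rule finite_subset[OF min_joins_subset finite_edges])

lemma min_joins_card: "J \<in> min_joins V E T p \<Longrightarrow> K \<in> min_joins V E T p \<Longrightarrow> card J = card K"
  unfolding min_joins_def by (blast intro: le_antisym)

lemma min_joins_signature:
  assumes G: "simple_graph V E" and J: "J \<in> min_joins V E T p" and K: "K \<in> min_joins V E T p"
  shows "edge_signature (indicator_monomial J) = edge_signature (indicator_monomial K)"
proof -
  have "J \<in> joins V E T p" "K \<in> joins V E T p" using J K by (auto simp: min_joins_def)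
  then show ?thesis
    using min_joins_card[OF J K] min_joins_finite[OF G J] min_joins_finite[OF G K]
    by (simp add: joins_iff[OF G] edge_signature_eq_iff[OF G] keys_indicator_monomial
        mono_degree_indicator_monomial)
qed

text \<open>
  The odd part of \<open>m\<close> is again a \<open>(T, p)\<close>-join, and it has at most \<open>mono_degree m = card L\<close>
  edges. As \<open>L\<close> is minimum, no room is left for a square factor: \<open>m\<close> is itself the monomial of
  a minimum join.
\<close>

lemma min_join_of_signature:
  assumes G: "simple_graph V E" and L: "L \<in> min_joins V E T p"
    and m: "Poly_Mapping.keys m \<subseteq> E" "edge_signature m = edge_signature (indicator_monomial L)"
  obtains J where "J \<in> min_joins V E T p" "m = indicator_monomial J"
proof -
  let ?J = "odd_support m"
  have L': "L \<in> joins V E T p" "\<And>J. J \<in> joins V E T p \<Longrightarrow> card L \<le> card J"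
    using L by (auto simp: min_joins_def)
  obtain r where r: "indicator_monomial ?J + (r + r) = m" using squarefree_part[of m] by (elim exE) (erule that[OF sym])
  have sub: "?J \<subseteq> E" using odd_support_subset_keys m(1) by (rule subset_trans)
  have finL: "finite L" by (rule min_joins_finite[OF G L])
  have eq: "mono_degree m = card L"
    "odd_support (vertex_monomial m) = odd_support (vertex_monomial (indicator_monomial L))"
    using m(2) edge_signature_eq_iff[OF G m(1), of "indicator_monomial L"] L' finL
    by (simp_all add: keys_indicator_monomial mono_degree_indicator_monomial joins_def)
  have deg: "card L = card ?J + 2 * mono_degree r"
    using arg_cong[OF r, of mono_degree] eq(1)
    by (simp add: mono_degree_add mono_degree_indicator_monomial)
  have "odd_support (vertex_monomial (indicator_monomial ?J)) = T"
    using eq(2) L'(1) odd_support_add_double[of "indicator_monomial ?J" r]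
    unfolding r by (simp add: joins_iff[OF G])
  moreover have "(of_nat (card ?J) :: bit) = p"
    using L'(1) deg by (auto simp: joins_def of_nat_bit_eq_iff)
  ultimately have J: "?J \<in> joins V E T p" using sub by (simp add: joins_iff[OF G])
  then have "card ?J = card L" "mono_degree r = 0" using L'(2) deg by fastforce+
  then have "?J \<in> min_joins V E T p" using J L'(2) by (simp add: min_joins_def)
  moreover have "m = indicator_monomial ?J"
    using \<open>mono_degree r = 0\<close> r by (simp add: mono_degree_eq_0)
  ultimately show ?thesis using that by blast
qed

lemma join_equiv_step:
  assumes "J \<in> min_joins V E T p" "K \<in> min_joins V E T p" "J \<inter> K \<noteq> {}"
  shows "(J, K) \<in> join_equiv V E T p"
proof -
  have "\<forall>i\<le>Suc 0. (if i = 0 then J else K) \<in> min_joins V E T p"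
    "\<forall>i<Suc 0. (if i = 0 then J else K) \<inter> (if Suc i = 0 then J else K) \<noteq> {}"
    using assms by auto
  then show ?thesis using assms(1,2) unfolding join_equiv_def mem_Collect_eq case_prod_conv
    by (intro conjI exI[of _ "Suc 0"] exI[of _ "\<lambda>i. if i = 0 then J else K"]) simp_all
qed

section \<open>Generation\<close>

text \<open>
  Generation of the Eulerian ideal, by induction on the degree. A monomial with a square factor is
  handled by the square exchange. For two squarefree monomials, given by \<open>(T, p)\<close>-joins \<open>J\<close> and
  \<open>K\<close> of equal size, there are two cases. If \<open>J\<close> and \<open>K\<close> are minimum, consecutive joins of a chain that
  witnesses \<open>\<sim>\<close> share an edge, hence are congruent by cancellation, and the hypothesis \<open>inequiv\<close>
  bridges different classes. Otherwise a smaller join, padded with an even power of a variable to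
  the degree of \<open>J\<close>, has a square factor, and both monomials are congruent to it.
\<close>

lemma edge_congruence:
  fixes I :: "('a set, 'k::comm_ring_1) mpoly set"
  assumes G: "simple_graph V E" and ideal: "ideal I (poly_ring E)"
    and squares: "\<And>e f. e \<in> E \<Longrightarrow> f \<in> E \<Longrightarrow>
      monomial_cong I (Poly_Mapping.single e 2) (Poly_Mapping.single f 2)"
    and inequiv: "\<And>T p J K. J \<in> min_joins V E T p \<Longrightarrow> K \<in> min_joins V E T p \<Longrightarrow>
      (J, K) \<notin> join_equiv V E T p \<Longrightarrow>
      \<exists>J' K'. (J, J') \<in> join_equiv V E T p \<and> (K', K) \<in> join_equiv V E T p \<and>
        monomial_cong I (indicator_monomial J') (indicator_monomial K')"
    and "Poly_Mapping.keys m \<subseteq> E" "Poly_Mapping.keys m' \<subseteq> E" "edge_signature m = edge_signature m'"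
  shows "monomial_cong I m m'"
proof -
  interpret square_congruence E I edge_signature
  proof (rule square_congruence.intro[OF ideal squares edge_signature_add_cancel])
    fix e f assume "e \<in> E" "f \<in> E"
    then show "edge_signature (Poly_Mapping.single e 2) = edge_signature (Poly_Mapping.single f 2)"
      by (simp only: edge_signature_square[OF G])
  qed (assumption, assumption, rule edge_signature_degree[OF G])
  show ?thesis using assms(5-)
  proof (induction "mono_degree m" arbitrary: m m' rule: less_induct)
    case less
    note m = less.prems
    have deg: "mono_degree m = mono_degree m'" by (rule h_degree[OF m])
    have IH: "monomial_cong I a b" if "Poly_Mapping.keys a \<subseteq> E" "Poly_Mapping.keys b \<subseteq> E"
        "edge_signature a = edge_signature b" "mono_degree a < mono_degree m" for a b
      using less.hyps that by blast
    have square_factor: "monomial_cong I a b"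
      if "mono_degree a = mono_degree m" "Poly_Mapping.keys a \<subseteq> E" "Poly_Mapping.keys b \<subseteq> E"
        "edge_signature a = edge_signature b" "2 \<le> Poly_Mapping.lookup a x" for a b x
      by (rule cong_of_square_factor[of a b x]) (use that IH in auto)
    consider (left) x where "2 \<le> Poly_Mapping.lookup m x"
      | (right) x where "2 \<le> Poly_Mapping.lookup m' x"
      | (squarefree) "\<And>x. Poly_Mapping.lookup m x < 2" "\<And>x. Poly_Mapping.lookup m' x < 2"
      by (meson not_less)
    then show ?case
    proof cases
      case left
      then show ?thesis using m by (intro square_factor) auto
    next
      case right
      then show ?thesis using m deg by (intro cong_sym[OF square_factor]) auto
    next
      case squarefree
      define J where "J = Poly_Mapping.keys m"
      define K where "K = Poly_Mapping.keys m'"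
      have mJ: "m = indicator_monomial J" and mK: "m' = indicator_monomial K"
        unfolding J_def K_def using squarefree by (auto intro!: indicator_monomial_of_keys)
      have sub: "J \<subseteq> E" "K \<subseteq> E" and fin: "finite J" "finite K"
        using m by (simp_all add: J_def K_def)
      define T where "T = odd_support (vertex_monomial m)"
      define p where "p = (of_nat (card J) :: bit)"
      have card: "card J = mono_degree m" "card K = mono_degree m"
        using deg by (simp_all add: mJ mK mono_degree_indicator_monomial)
      have J: "J \<in> joins V E T p"
        using sub by (simp add: joins_iff[OF G] T_def p_def mJ)
      have K: "K \<in> joins V E T p"
        using sub card m edge_signature_eq_iff[OF G, of m m']
        by (simp add: joins_iff[OF G] T_def p_def) (simp add: mK)
      show ?thesis
      proof (cases "J \<in> min_joins V E T p")
        case True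
        then have J_min: "J \<in> min_joins V E T p" and K_min: "K \<in> min_joins V E T p"
          using K card by (auto simp: min_joins_def)
        have equiv_cong: "monomial_cong I (indicator_monomial A) (indicator_monomial B)"
          if AB: "(A, B) \<in> join_equiv V E T p" for A B
        proof -
          obtain r and L :: "nat \<Rightarrow> 'a set set" where
            L: "\<forall>i\<le>r. L i \<in> min_joins V E T p" "L 0 = A" "L r = B"
               "\<forall>i<r. L i \<inter> L (Suc i) \<noteq> {}"
            using AB unfolding join_equiv_def by auto
          have "monomial_cong I (indicator_monomial A) (indicator_monomial (L i))" if "i \<le> r" for i
            using that
          proof (induction i)
            case 0
            then show ?case by (simp add: L(2) cong_refl)
          next
            case (Suc i)
            then have i: "L i \<in> min_joins V E T p" "L (Suc i) \<in> min_joins V E T p" using L(1) by auto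
            have fin: "finite (L i)" "finite (L (Suc i))" using min_joins_finite[OF G] i by auto
            have "L i \<inter> L (Suc i) \<noteq> {}" using L(4) Suc.prems by simp
            then obtain x where x: "x \<in> L i" "x \<in> L (Suc i)" by blast
            have card_L: "card (L i) = mono_degree m" using min_joins_card[OF i(1) J_min] card by simp
            have step: "monomial_cong I (indicator_monomial (L i)) (indicator_monomial (L (Suc i)))"
            proof (rule cong_of_common_variable)
              show "Poly_Mapping.keys (indicator_monomial (L i)) \<subseteq> E"
                "Poly_Mapping.keys (indicator_monomial (L (Suc i))) \<subseteq> E"
                using i by (simp_all add: keys_indicator_monomial fin min_joins_subset)
              show "edge_signature (indicator_monomial (L i)) = edge_signature (indicator_monomial (L (Suc i)))"
                by (rule min_joins_signature[OF G i])
              show "x \<in> Poly_Mapping.keys (indicator_monomial (L i))"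
                "x \<in> Poly_Mapping.keys (indicator_monomial (L (Suc i)))"
                using x by (simp_all add: keys_indicator_monomial fin)
            next
              fix a b :: "'a set \<Rightarrow>\<^sub>0 nat"
              assume "mono_degree a < mono_degree (indicator_monomial (L i))"
              then have lt: "mono_degree a < mono_degree m"
                by (simp only: mono_degree_indicator_monomial card_L)
              assume "Poly_Mapping.keys a \<subseteq> E" "Poly_Mapping.keys b \<subseteq> E"
                "edge_signature a = edge_signature b"
              then show "monomial_cong I a b" using lt by (rule IH)
            qed
            show ?case by (rule cong_trans[OF Suc.IH step]) (use Suc.prems in simp)
          qed
          from this[of r] L(3) show ?thesis by simp
        qed
        show ?thesis
        proof (cases "(J, K) \<in> join_equiv V E T p")
          case True
          then show ?thesis unfolding mJ mK by (rule equiv_cong)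
        next
          case False
          then obtain J' K' where reps: "(J, J') \<in> join_equiv V E T p"
              "(K', K) \<in> join_equiv V E T p"
              "monomial_cong I (indicator_monomial J') (indicator_monomial K')"
            using inequiv[OF J_min K_min] by blast
          show ?thesis unfolding mJ mK
            by (rule cong_trans[OF equiv_cong[OF reps(1)] cong_trans[OF reps(3) equiv_cong[OF reps(2)]]])
        qed
      next
        case False
        then obtain M where M: "M \<in> joins V E T p" "card M < card J"
          using J by (auto simp: min_joins_def not_le)
        have "(of_nat (card M) :: bit) = of_nat (card J)"
          using M(1) J unfolding joins_def mem_Collect_eq by (elim conjE) (rule trans[OF _ sym])
        then have "even (card M) \<longleftrightarrow> even (card J)" by (rule of_nat_bit_eq_iff[THEN iffD1])
        with M(2) have "card J = card M + ((card J - card M) div 2 + (card J - card M) div 2)"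
          by presburger
        then obtain k where k: "card J = card M + (k + k)" ..
        with M(2) have "k \<ge> 1" by simp
        obtain x where x: "x \<in> J" using M(2) by fastforce
        have subM: "M \<subseteq> E" using M(1) by (simp add: joins_def)
        have finM: "finite M" using finite_subset[OF subM finite_edges[OF G]] .
        \<comment> \<open>The parities of \<open>card M\<close> and \<open>card J\<close> agree, so padding by the square of \<open>x\<^sup>k\<close> reaches the
          right degree without changing the odd vertices.\<close>
        define s where "s = indicator_monomial M + (Poly_Mapping.single x k + Poly_Mapping.single x k)"
        have keys_s: "Poly_Mapping.keys s \<subseteq> E"
        proof
          fix e assume "e \<in> Poly_Mapping.keys s"
          then have "e \<in> M \<or> e = x"
            using finM by (auto simp: s_def in_keys_iff lookup_add lookup_indicator_monomial lookup_single when_def split: if_splits)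
          then show "e \<in> E" using subM x sub(1) by blast
        qed
        have deg_s: "mono_degree s = mono_degree m"
          using k card by (simp add: s_def mono_degree_add mono_degree_indicator_monomial mono_degree_single)
        have "odd_support (vertex_monomial s) = T"
          using M(1) unfolding s_def odd_support_add_double by (simp add: joins_iff[OF G])
        then have sig: "edge_signature s = edge_signature m"
          using edge_signature_eq_iff[OF G keys_s m(1)] deg_s by (simp add: T_def)
        have "2 \<le> Poly_Mapping.lookup s x" using \<open>k \<ge> 1\<close> by (simp add: s_def lookup_add)
        then have "monomial_cong I s m" "monomial_cong I s m'"
          using square_factor[OF deg_s keys_s m(1) sig] square_factor[OF deg_s keys_s m(2)] sig m(3)
          by simp_all
        then show ?thesis by (rule cong_trans[OF cong_sym])
      qed
    qed
  qed
qed

section \<open>Separating the generators\<close>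

lemma join_equiv_min_joins:
  assumes "(J, K) \<in> join_equiv V E T p"
  shows "J \<in> min_joins V E T p" "K \<in> min_joins V E T p"
  using assms by (auto simp: join_equiv_def)

lemma representative_exists:
  assumes S: "join_representatives V E T p S" and J: "J \<in> min_joins V E T p"
  obtains L where "L \<in> S" "(J, L) \<in> join_equiv V E T p"
proof -
  have "join_equiv V E T p `` {J} \<in> min_joins V E T p // join_equiv V E T p"
    by (rule quotientI[OF J])
  then have "\<exists>L. L \<in> S \<inter> join_equiv V E T p `` {J}"
    using S unfolding join_representatives_def by blast
  then show ?thesis using that by blast
qed

lemma representative_unique:
  assumes S: "join_representatives V E T p S" and J: "J \<in> S" and L: "L \<in> S"
    and JL: "(J, L) \<in> join_equiv V E T p"
  shows "J = L"
proof -
  have min: "J \<in> min_joins V E T p" using S J by (auto simp: join_representatives_def)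
  have JJ: "(J, J) \<in> join_equiv V E T p"
    by (rule equiv_class_self[OF join_equiv_equiv min, unfolded Image_singleton_iff])
  have "join_equiv V E T p `` {J} \<in> min_joins V E T p // join_equiv V E T p"
    by (rule quotientI[OF min])
  then have "\<exists>!M. M \<in> S \<inter> join_equiv V E T p `` {J}"
    using S unfolding join_representatives_def by blast
  then show ?thesis using J L JL JJ by blast
qed

text \<open>
  The reason why relations between smaller joins never link two classes of minimum joins: applying
  such a relation inside a minimum join \<open>L\<close> leaves the cofactor \<open>u\<close> untouched, so the resulting
  minimum join shares the edges of \<open>u\<close> with \<open>L\<close>.
\<close>

lemma join_equiv_of_common_factor:
  assumes G: "simple_graph V E"
    and PQ: "P \<in> min_joins V E T' p'" "Q \<in> min_joins V E T' p'"
    and L: "L \<in> min_joins V E T p" "u + indicator_monomial P = indicator_monomial L"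
    and u: "u \<noteq> 0"
  shows "\<exists>L'. (L, L') \<in> join_equiv V E T p \<and> u + indicator_monomial Q = indicator_monomial L'"
proof -
  have fin: "finite P" "finite Q" "finite L" using PQ L(1) min_joins_finite[OF G] by blast+
  have keys_u: "Poly_Mapping.keys u \<subseteq> L"
  proof
    fix x assume "x \<in> Poly_Mapping.keys u"
    then have "Poly_Mapping.lookup (indicator_monomial L) x \<noteq> 0"
      unfolding L(2)[symmetric] by (simp add: lookup_add in_keys_iff)
    then show "x \<in> L" using fin by (simp add: lookup_indicator_monomial split: if_splits)
  qed
  have sig: "edge_signature (u + indicator_monomial Q) = edge_signature (indicator_monomial L)"
    using min_joins_signature[OF G PQ] unfolding L(2)[symmetric] edge_signature_add_cancel by (rule sym)
  have "Poly_Mapping.keys (u + indicator_monomial Q) \<subseteq> Poly_Mapping.keys u \<union> Q"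
    using Poly_Mapping.keys_add[of u "indicator_monomial Q"] fin by (simp add: keys_indicator_monomial)
  also have "\<dots> \<subseteq> E"
    using keys_u min_joins_subset[OF L(1)] min_joins_subset[OF PQ(2)] by blast
  finally obtain L' where L': "L' \<in> min_joins V E T p" "u + indicator_monomial Q = indicator_monomial L'"
    using min_join_of_signature[OF G L(1) _ sig] by blast
  obtain x where x: "x \<in> Poly_Mapping.keys u" using u by (metis all_not_in_conv keys_eq_empty)
  then have "Poly_Mapping.lookup (indicator_monomial L') x \<noteq> 0"
    unfolding L'(2)[symmetric] by (simp add: lookup_add in_keys_iff)
  then have "x \<in> L'"
    using min_joins_finite[OF G L'(1)] by (simp add: lookup_indicator_monomial split: if_splits)
  then have "(L, L') \<in> join_equiv V E T p"
    using x keys_u by (intro join_equiv_step L(1) L'(1)) blast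
  with L'(2) show ?thesis by blast
qed

text \<open>
  If a minimum join has at most one edge, it is determined by \<open>T\<close>: it is empty, or its only edge
  is the set \<open>T\<close> itself. Consequently the binomials of joins do not involve any divisor of
  \<open>t\<^sub>e\<^sup>2\<close>.
\<close>

lemma min_joins_not_subset_singleton:
  assumes G: "simple_graph V E" and JK: "J \<in> min_joins V E T p" "K \<in> min_joins V E T p"
    and "J \<noteq> K" and "e \<in> E"
  shows "\<not> J \<subseteq> {e}"
proof
  assume "J \<subseteq> {e}"
  then consider "J = {}" | "J = {e}" by blast
  then show False
  proof cases
    case 1
    then have "card K = 0" using min_joins_card[OF JK] by simp
    then show False using 1 \<open>J \<noteq> K\<close> min_joins_finite[OF G JK(2)] by simp
  next
    case 2
    have odd: "{v \<in> V. odd (deg {f} v)} = f" if "f \<in> E" for f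
    proof -
      have "deg {f} v = (if v \<in> f then 1 else 0)" for v
      proof -
        have "{e \<in> {f}. v \<in> e} = (if v \<in> f then {f} else {})" by auto
        then show ?thesis by (simp add: deg_def)
      qed
      then show ?thesis using simple_graph_edge(1)[OF G that] by auto
    qed
    have "card K = 1" using min_joins_card[OF JK] 2 by simp
    then obtain f where f: "K = {f}" by (rule card_1_singletonE)
    have "f \<in> E" using f min_joins_subset[OF JK(2)] by simp
    have "{v \<in> V. odd (deg {e} v)} = T" "{v \<in> V. odd (deg {f} v)} = T"
      using JK unfolding 2 f min_joins_def joins_def by blast+
    then have "e = f" using odd[OF \<open>e \<in> E\<close>] odd[OF \<open>f \<in> E\<close>] by simp
    then show False using 2 f \<open>J \<noteq> K\<close> by simp
  qed
qed

lemma indicator_monomial_not_dvd_square: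
  assumes "finite J" "\<not> J \<subseteq> {e}"
  shows "u + indicator_monomial J \<noteq> Poly_Mapping.single e k"
proof
  assume eq: "u + indicator_monomial J = Poly_Mapping.single e k"
  obtain f where f: "f \<in> J" "f \<noteq> e" using assms(2) by blast
  have "Poly_Mapping.lookup (u + indicator_monomial J) f \<noteq> 0"
    using f assms(1) by (simp add: lookup_add lookup_indicator_monomial)
  then show False unfolding eq using f by (simp add: lookup_single)
qed

lemma square_not_dvd_indicator_monomial:
  assumes "finite J"
  shows "u + Poly_Mapping.single e 2 \<noteq> indicator_monomial J"
proof
  assume eq: "u + Poly_Mapping.single e 2 = indicator_monomial J"
  have "Poly_Mapping.lookup (u + Poly_Mapping.single e 2) e \<ge> 2" by (simp add: lookup_add)
  then show False unfolding eq using assms by (simp add: lookup_indicator_monomial split: if_splits)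
qed

lemma square_not_dvd_square:
  assumes "e \<noteq> f"
  shows "u + Poly_Mapping.single f (2::nat) \<noteq> Poly_Mapping.single e 2"
proof
  assume eq: "u + Poly_Mapping.single f 2 = Poly_Mapping.single e 2"
  have "Poly_Mapping.lookup (u + Poly_Mapping.single f 2) f \<ge> 2" by (simp add: lookup_add)
  then show False unfolding eq using assms by (simp add: lookup_single)
qed

lemma inj_indicator_monomial:
  "finite J \<Longrightarrow> finite K \<Longrightarrow> indicator_monomial J = indicator_monomial K \<Longrightarrow> J = K"
  using keys_indicator_monomial by metis

lemma homogeneous_binomial:
  assumes "mono_degree a = mono_degree b"
  shows "homogeneous (monomial a - monomial b)"
proof -
  have "Poly_Mapping.keys (monomial a - monomial b) \<subseteq> {a, b}"
    using Poly_Mapping.keys_diff[of "monomial a" "monomial b"] by auto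
  then show ?thesis unfolding homogeneous_def using assms by (intro exI[of _ "mono_degree a"]) auto
qed

section \<open>The generating set\<close>

locale representative_choice =
  fixes V :: "'a set" and E :: "'a set set" and l :: "'a set"
    and S :: "'a set \<Rightarrow> bit \<Rightarrow> 'a set set set"
    and K :: "'a set \<Rightarrow> bit \<Rightarrow> 'a set set"
  assumes graph: "simple_graph V E" and l: "l \<in> E"
    and S: "\<And>T p. (T, p) \<in> join_pairs_star V E \<Longrightarrow> join_representatives V E T p (S T p)"
    and K: "\<And>T p. (T, p) \<in> join_pairs_star V E \<Longrightarrow> K T p \<in> S T p"
begin

definition generators :: "('a set, 'k::comm_ring_1) mpoly set" where
  "generators =
     {(var e)\<^sup>2 - (var l)\<^sup>2 | e. e \<in> E - {l}} \<union>
     (\<Union>(T, p) \<in> join_pairs_star V E. {edge_monom J - edge_monom (K T p) | J. J \<in> S T p - {K T p}})"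

definition relevant_join :: "'a set \<Rightarrow> bit \<Rightarrow> 'a set set \<Rightarrow> bool" where
  "relevant_join T p J \<longleftrightarrow> (T, p) \<in> join_pairs_star V E \<and> J \<in> S T p \<and> J \<noteq> K T p"

lemma representative_min:
  "(T, p) \<in> join_pairs_star V E \<Longrightarrow> J \<in> S T p \<Longrightarrow> J \<in> min_joins V E T p"
  using S by (auto simp: join_representatives_def)

lemma relevant_join_min:
  assumes "relevant_join T p J"
  shows "J \<in> min_joins V E T p" "K T p \<in> min_joins V E T p"
  using assms representative_min K by (auto simp: relevant_join_def)

lemma generators_cases:
  assumes "b \<in> generators"
  obtains (square) e where "e \<in> E" "e \<noteq> l"
      "b = monomial (Poly_Mapping.single e 2) - monomial (Poly_Mapping.single l 2)"
    | (join) T p J where "relevant_join T p J"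
      "b = monomial (indicator_monomial J) - monomial (indicator_monomial (K T p))"
proof -
  from assms consider e where "e \<in> E" "e \<noteq> l" "b = (var e)\<^sup>2 - (var l)\<^sup>2"
    | T p J where "relevant_join T p J" "b = edge_monom J - edge_monom (K T p)"
    unfolding generators_def relevant_join_def by blast
  then show thesis
    by cases (rule square, assumption, assumption, simp only: var_power,
        rule join, assumption, simp only: edge_monom_eq)
qed

lemma generators_binomial:
  assumes "b \<in> generators"
  shows "\<exists>a a'. b = monomial a - monomial a' \<and> Poly_Mapping.keys a \<subseteq> E \<and>
      Poly_Mapping.keys a' \<subseteq> E \<and> edge_signature a = edge_signature a'"
  using assms
proof (cases rule: generators_cases)
  case (square e)
  show ?thesis
    by (rule exI[of _ "Poly_Mapping.single e 2"], rule exI[of _ "Poly_Mapping.single l 2"])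
       (simp add: square l edge_signature_square[OF graph square(1)] edge_signature_square[OF graph l])
next
  case (join T p J)
  note J = relevant_join_min[OF join(1)]
  show ?thesis
    using min_joins_subset[OF J(1)] min_joins_subset[OF J(2)]
      min_joins_finite[OF graph J(1)] min_joins_finite[OF graph J(2)] min_joins_signature[OF graph J]
    by (intro exI[of _ "indicator_monomial J"] exI[of _ "indicator_monomial (K T p)"])
       (simp add: join(2) keys_indicator_monomial)
qed

lemma generators_in_poly_ring: "generators \<subseteq> carrier (poly_ring E)"
proof
  fix b :: "('a set, 'k::comm_ring_1) mpoly"
  assume "b \<in> generators"
  then obtain a a' where "b = monomial a - monomial a'" "Poly_Mapping.keys a \<subseteq> E"
      "Poly_Mapping.keys a' \<subseteq> E"
    using generators_binomial by blast
  then show "b \<in> carrier (poly_ring E)" by (simp add: poly_ring_closed single_in_poly_ring)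
qed

lemma generators_homogeneous:
  assumes b: "b \<in> generators"
  shows "homogeneous b"
proof -
  obtain a a' where a: "b = monomial a - monomial a'" "Poly_Mapping.keys a \<subseteq> E"
      "Poly_Mapping.keys a' \<subseteq> E" "edge_signature a = edge_signature a'"
    using generators_binomial[OF b] by blast
  show ?thesis
    unfolding a(1) by (rule homogeneous_binomial[OF edge_signature_degree[OF graph a(2-4)]])
qed

text \<open>
  The hypotheses of \<open>edge_congruence\<close> hold because every square is congruent to that of \<open>l\<close>, and
  every minimum join is equivalent to a representative, which is congruent to \<open>K T p\<close>.
\<close>

lemma generators_congruence:
  fixes m m' :: "'a set \<Rightarrow>\<^sub>0 nat"
  assumes m: "Poly_Mapping.keys m \<subseteq> E" "Poly_Mapping.keys m' \<subseteq> E"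
    "edge_signature m = edge_signature m'"
  shows "monomial_cong (Idl\<^bsub>poly_ring E\<^esub> (generators :: ('a set, 'k::comm_ring_1) mpoly set)) m m'"
proof -
  interpret cring "poly_ring E :: ('a set, 'k) mpoly ring" by (rule poly_ring_cring)
  let ?I = "Idl\<^bsub>poly_ring E\<^esub> (generators :: ('a set, 'k) mpoly set)"
  have ideal: "ideal ?I (poly_ring E)" by (rule genideal_ideal[OF generators_in_poly_ring])
  have mem: "b \<in> ?I" if "b \<in> generators" for b
    using genideal_self[OF generators_in_poly_ring] that by blast
  have refl: "monomial_cong ?I a a" for a
    using poly_ideal_closed(1)[OF ideal] by (simp add: monomial_cong_def)
  have common: "monomial_cong ?I a b" if "monomial_cong ?I a c" "monomial_cong ?I b c" for a b c
    using poly_ideal_closed(2)[OF ideal that(1)[unfolded monomial_cong_def]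
        poly_ideal_closed(3)[OF ideal that(2)[unfolded monomial_cong_def]]]
    by (simp add: monomial_cong_def)
  have to_l: "monomial_cong ?I (Poly_Mapping.single e 2) (Poly_Mapping.single l 2)" if e: "e \<in> E" for e
  proof (cases "e = l")
    case False
    then have "(var e)\<^sup>2 - (var l)\<^sup>2 \<in> generators" using e unfolding generators_def by blast
    then show ?thesis using mem unfolding monomial_cong_def var_power by blast
  qed (simp add: refl)
  have to_K: "monomial_cong ?I (indicator_monomial J) (indicator_monomial (K T p))"
    if star: "(T, p) \<in> join_pairs_star V E" and J: "J \<in> S T p" for T p J
  proof (cases "J = K T p")
    case False
    then have "edge_monom J - edge_monom (K T p) \<in> generators"
      using star J unfolding generators_def by blast
    then show ?thesis using mem unfolding monomial_cong_def edge_monom_eq by blast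
  qed (simp add: refl)
  show ?thesis
  proof (rule edge_congruence[OF graph ideal _ _ m])
    fix e f assume "e \<in> E" "f \<in> E"
    then show "monomial_cong ?I (Poly_Mapping.single e 2) (Poly_Mapping.single f 2)"
      by (intro common[OF to_l to_l])
  next
    fix T p J M
    assume JM: "J \<in> min_joins V E T p" "M \<in> min_joins V E T p" "(J, M) \<notin> join_equiv V E T p"
    then have "J \<in> joins V E T p" by (simp add: min_joins_def)
    then have "(T, p) \<in> join_pairs V E" unfolding join_pairs_def by (auto simp: joins_def)
    then have star: "(T, p) \<in> join_pairs_star V E" unfolding join_pairs_star_def using JM by blast
    obtain J' where J': "J' \<in> S T p" "(J, J') \<in> join_equiv V E T p"
      using representative_exists[OF S[OF star] JM(1)] .
    obtain M' where M': "M' \<in> S T p" "(M, M') \<in> join_equiv V E T p"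
      using representative_exists[OF S[OF star] JM(2)] .
    have "(M', M) \<in> join_equiv V E T p"
      using M'(2) join_equiv_equiv[of V E T p] by (auto elim: equivE dest: symD)
    then show "\<exists>J' M'. (J, J') \<in> join_equiv V E T p \<and> (M', M) \<in> join_equiv V E T p \<and>
        monomial_cong ?I (indicator_monomial J') (indicator_monomial M')"
      using J'(2) common[OF to_K[OF star J'(1)] to_K[OF star M'(1)]] by blast
  qed
qed

lemma generators_generate:
  "Idl\<^bsub>poly_ring E\<^esub> generators = (eulerian_ideal V E :: ('a set, 'k::comm_ring_1) mpoly set)"
proof (rule Set.set_eqI)
  fix f :: "('a set, 'k) mpoly"
  have "f \<in> Idl\<^bsub>poly_ring E\<^esub> generators \<longleftrightarrow>
      f \<in> carrier (poly_ring E) \<and> (\<forall>c. coeff_sum (edge_signature -` {c}) f = 0)"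
  proof (rule binomial_ideal_iff)
    fix m m' :: "'a set \<Rightarrow>\<^sub>0 nat"
    assume "Poly_Mapping.keys m \<subseteq> E" "Poly_Mapping.keys m' \<subseteq> E" "edge_signature m = edge_signature m'"
    then show "monomial m - monomial m' \<in> Idl\<^bsub>poly_ring E\<^esub> (generators :: ('a set, 'k) mpoly set)"
      by (rule generators_congruence[unfolded monomial_cong_def])
  next
    fix u a a' :: "'a set \<Rightarrow>\<^sub>0 nat" assume "edge_signature a = edge_signature a'"
    then show "edge_signature (u + a) = edge_signature (u + a')" by (simp only: edge_signature_add_cancel)
  qed (rule generators_binomial)
  then show "f \<in> Idl\<^bsub>poly_ring E\<^esub> generators \<longleftrightarrow> f \<in> eulerian_ideal V E"
    by (simp only: eulerian_ideal_iff[OF graph])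
qed

text \<open>
  The form in which \<open>coeff_sum_ideal\<close> is used for irredundancy: it suffices to find a set of monomials
  that separates the two terms of \<open>b\<close> but none of the monomial multiples of the other generators.
\<close>

lemma not_generated_by_others:
  fixes b :: "('a set, 'k::comm_ring_1) mpoly"
  assumes nonzero: "coeff_sum A b \<noteq> 0"
    and square: "\<And>e u. e \<in> E \<Longrightarrow> e \<noteq> l \<Longrightarrow>
      b \<noteq> monomial (Poly_Mapping.single e 2) - monomial (Poly_Mapping.single l 2) \<Longrightarrow>
      u + Poly_Mapping.single e 2 \<in> A \<longleftrightarrow> u + Poly_Mapping.single l 2 \<in> A"
    and join: "\<And>T p J u. relevant_join T p J \<Longrightarrow>
      b \<noteq> monomial (indicator_monomial J) - monomial (indicator_monomial (K T p)) \<Longrightarrow>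
      u + indicator_monomial J \<in> A \<longleftrightarrow> u + indicator_monomial (K T p) \<in> A"
  shows "b \<notin> Idl\<^bsub>poly_ring E\<^esub> (generators - {b})"
proof
  assume "b \<in> Idl\<^bsub>poly_ring E\<^esub> (generators - {b})"
  then have "coeff_sum A b = 0"
  proof (rule coeff_sum_ideal[rotated])
    fix c assume "c \<in> generators - {b}"
    then have c: "c \<in> generators" and bc: "b \<noteq> c" by auto
    from c show "\<exists>a a'. c = monomial a - monomial a' \<and> Poly_Mapping.keys a \<subseteq> E \<and>
        Poly_Mapping.keys a' \<subseteq> E \<and>
        (\<forall>u. Poly_Mapping.keys u \<subseteq> E \<longrightarrow> (u + a \<in> A \<longleftrightarrow> u + a' \<in> A))"
    proof (cases rule: generators_cases)
      case e: (square e)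
      show ?thesis
        using square[OF e(1,2)] bc e(1) l unfolding e(3)
        by (intro exI[of _ "Poly_Mapping.single e 2"] exI[of _ "Poly_Mapping.single l 2"]) simp
    next
      case J: (join T p J)
      note min = relevant_join_min[OF J(1)]
      show ?thesis
        using join[OF J(1)] bc min_joins_subset[OF min(1)] min_joins_subset[OF min(2)]
          min_joins_finite[OF graph min(1)] min_joins_finite[OF graph min(2)] unfolding J(2)
        by (intro exI[of _ "indicator_monomial J"] exI[of _ "indicator_monomial (K T p)"])
           (simp add: keys_indicator_monomial)
    qed
  qed
  with nonzero show False ..
qed

text \<open>
  The separating set consists of \<open>t\<^sub>e\<^sup>2\<close> alone: no term of another generator divides it.
\<close>

lemma square_irredundant:
  fixes b :: "('a set, 'k::comm_ring_1) mpoly"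
  assumes e: "e \<in> E" "e \<noteq> l"
    and b: "b = monomial (Poly_Mapping.single e 2) - monomial (Poly_Mapping.single l 2)"
  shows "b \<notin> Idl\<^bsub>poly_ring E\<^esub> (generators - {b})"
proof (rule not_generated_by_others[of "{Poly_Mapping.single e 2}"])
  have "Poly_Mapping.single l 2 \<noteq> (Poly_Mapping.single e 2 :: 'a set \<Rightarrow>\<^sub>0 nat)"
    using square_not_dvd_square[of e l 0] e(2) by simp
  then show "coeff_sum {Poly_Mapping.single e 2} b \<noteq> 0"
    by (simp add: b coeff_sum_diff coeff_sum_single)
next
  fix f and u :: "'a set \<Rightarrow>\<^sub>0 nat"
  assume f: "f \<in> E" "f \<noteq> l"
    "b \<noteq> monomial (Poly_Mapping.single f 2) - monomial (Poly_Mapping.single l 2)"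
  then have "f \<noteq> e" using b by blast
  then show "u + Poly_Mapping.single f 2 \<in> {Poly_Mapping.single e 2} \<longleftrightarrow>
      u + Poly_Mapping.single l 2 \<in> {Poly_Mapping.single e 2}"
    using square_not_dvd_square[of e f u] square_not_dvd_square[of e l u] e(2) by simp
next
  fix T p J and u :: "'a set \<Rightarrow>\<^sub>0 nat"
  assume J: "relevant_join T p J"
  note min = relevant_join_min[OF J]
  have ne: "J \<noteq> K T p" using J by (simp add: relevant_join_def)
  show "u + indicator_monomial J \<in> {Poly_Mapping.single e 2} \<longleftrightarrow>
      u + indicator_monomial (K T p) \<in> {Poly_Mapping.single e 2}"
    using indicator_monomial_not_dvd_square[OF min_joins_finite[OF graph min(1)]
        min_joins_not_subset_singleton[OF graph min ne e(1)], of u 2]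
      indicator_monomial_not_dvd_square[OF min_joins_finite[OF graph min(2)]
        min_joins_not_subset_singleton[OF graph min(2,1) ne[symmetric] e(1)], of u 2]
    by simp
qed

text \<open>
  The separating set is the equivalence class \<open>A\<close> of \<open>J\<close>. Squares divide no monomial of \<open>A\<close>. A proper
  multiple of another join binomial cannot leave \<open>A\<close>, by \<open>join_equiv_of_common_factor\<close>, and the
  other binomials themselves avoid \<open>A\<close> because \<open>J\<close> is the only chosen representative in its class.
\<close>

lemma join_irredundant:
  fixes b :: "('a set, 'k::comm_ring_1) mpoly"
  assumes J: "relevant_join T p J"
    and b: "b = monomial (indicator_monomial J) - monomial (indicator_monomial (K T p))"
  shows "b \<notin> Idl\<^bsub>poly_ring E\<^esub> (generators - {b})"
proof -
  define A where "A = indicator_monomial ` {L. (J, L) \<in> join_equiv V E T p}"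
  have star: "(T, p) \<in> join_pairs_star V E" and J_S: "J \<in> S T p" and ne: "J \<noteq> K T p"
    using J by (simp_all add: relevant_join_def)
  note min = relevant_join_min[OF J]
  have mem_A: "indicator_monomial M \<in> A \<longleftrightarrow> (J, M) \<in> join_equiv V E T p"
    if M: "M \<in> min_joins V E T' p'" for M T' p'
  proof
    assume "indicator_monomial M \<in> A"
    then obtain L where L: "(J, L) \<in> join_equiv V E T p" "indicator_monomial M = indicator_monomial L"
      unfolding A_def by blast
    have "M = L"
      using inj_indicator_monomial[OF _ _ L(2)] min_joins_finite[OF graph M]
        min_joins_finite[OF graph join_equiv_min_joins(2)[OF L(1)]] by blast
    then show "(J, M) \<in> join_equiv V E T p" using L(1) by simp
  qed (auto simp: A_def)
  have only_J: "M = J" if M: "(T', p') \<in> join_pairs_star V E" "M \<in> S T' p'"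
      and equiv: "(J, M) \<in> join_equiv V E T p" for M T' p'
  proof -
    have "M \<in> min_joins V E T' p'" "M \<in> min_joins V E T p"
      using representative_min[OF M] join_equiv_min_joins(2)[OF equiv] .
    then have "T' = T" "p' = p" unfolding min_joins_def joins_def by blast+
    then show ?thesis using representative_unique[OF S[OF star] J_S _ equiv] M by simp
  qed
  have same_pair: "T' = T \<and> p' = p" if "J \<in> min_joins V E T' p'" for T' p'
    using that min(1) unfolding min_joins_def joins_def by blast
  show ?thesis
  proof (rule not_generated_by_others[of A])
    have "(J, J) \<in> join_equiv V E T p"
      by (rule equiv_class_self[OF join_equiv_equiv min(1), unfolded Image_singleton_iff])
    then have "indicator_monomial J \<in> A" using mem_A[OF min(1)] by blast
    moreover have "indicator_monomial (K T p) \<notin> A"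
      using mem_A[OF min(2)] only_J[OF star K[OF star]] ne by blast
    ultimately show "coeff_sum A b \<noteq> 0" by (simp add: b coeff_sum_diff coeff_sum_single)
  next
    fix f u
    have "u + Poly_Mapping.single g 2 \<notin> A" for g
      using square_not_dvd_indicator_monomial[OF
          min_joins_finite[OF graph join_equiv_min_joins(2)], of J _ T p u g]
      unfolding A_def by blast
    then show "u + Poly_Mapping.single f 2 \<in> A \<longleftrightarrow> u + Poly_Mapping.single l 2 \<in> A" by simp
  next
    fix T' p' M u
    assume M: "relevant_join T' p' M"
      and bM: "b \<noteq> monomial (indicator_monomial M) - monomial (indicator_monomial (K T' p'))"
    have star': "(T', p') \<in> join_pairs_star V E" and M_S: "M \<in> S T' p'"
      using M by (simp_all add: relevant_join_def)
    note min' = relevant_join_min[OF M]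
    show "u + indicator_monomial M \<in> A \<longleftrightarrow> u + indicator_monomial (K T' p') \<in> A"
    proof (cases "u = 0")
      case True
      have "M \<noteq> J" using min'(1) bM b same_pair[of T' p'] by blast
      then have "(J, M) \<notin> join_equiv V E T p" using only_J[OF star' M_S] by blast
      moreover have "K T' p' \<noteq> J" using min'(2) ne same_pair[of T' p'] by metis
      then have "(J, K T' p') \<notin> join_equiv V E T p" using only_J[OF star' K[OF star']] by blast
      ultimately show ?thesis using True mem_A[OF min'(1)] mem_A[OF min'(2)] by simp
    next
      case False
      have transfer: "u + indicator_monomial Q \<in> A"
        if PQ: "P \<in> min_joins V E T' p'" "Q \<in> min_joins V E T' p'"
          and P: "u + indicator_monomial P \<in> A" for P Q
      proof -
        obtain L where L: "(J, L) \<in> join_equiv V E T p" "u + indicator_monomial P = indicator_monomial L"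
          using P unfolding A_def by blast
        obtain L' where L': "(L, L') \<in> join_equiv V E T p" "u + indicator_monomial Q = indicator_monomial L'"
          using join_equiv_of_common_factor[OF graph PQ join_equiv_min_joins(2)[OF L(1)] L(2) False]
          by blast
        have "(J, L') \<in> join_equiv V E T p"
          using join_equiv_equiv[of V E T p] L(1) L'(1) by (auto elim: equivE dest: transD)
        then show ?thesis unfolding A_def L'(2) by blast
      qed
      show ?thesis using transfer[OF min'] transfer[OF min'(2,1)] by blast
    qed
  qed
qed

theorem generators_minimal:
  "minimal_homogeneous_generating_set E
     (eulerian_ideal V E :: ('a set, 'k::comm_ring_1) mpoly set) generators"
proof -
  interpret cring "poly_ring E :: ('a set, 'k) mpoly ring" by (rule poly_ring_cring)
  let ?B = "generators :: ('a set, 'k) mpoly set"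
  have "Idl\<^bsub>poly_ring E\<^esub> B' \<noteq> eulerian_ideal V E" if B': "B' \<subset> ?B" for B'
  proof -
    obtain b where b: "b \<in> ?B" "b \<notin> B'" using B' by blast
    have sub: "?B - {b} \<subseteq> carrier (poly_ring E)" using generators_in_poly_ring by blast
    have "B' \<subseteq> ?B - {b}" using B' b by blast
    then have "Idl\<^bsub>poly_ring E\<^esub> B' \<subseteq> Idl\<^bsub>poly_ring E\<^esub> (?B - {b})"
      by (rule subset_Idl_subset[OF sub])
    moreover have "b \<notin> Idl\<^bsub>poly_ring E\<^esub> (?B - {b})"
      using b(1) square_irredundant join_irredundant by (cases rule: generators_cases) blast+
    moreover have "b \<in> eulerian_ideal V E"
      using genideal_self[OF generators_in_poly_ring] b(1) unfolding generators_generate by blast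
    ultimately show ?thesis by blast
  qed
  then show ?thesis
    unfolding minimal_homogeneous_generating_set_def
    using generators_in_poly_ring generators_homogeneous generators_generate by blast
qed

end

theorem theorem3p5:
  fixes n :: nat and V :: "nat set" and E :: "nat set set" and l :: "nat set"
    and S :: "nat set \<Rightarrow> bit \<Rightarrow> nat set set set"
    and K :: "nat set \<Rightarrow> bit \<Rightarrow> nat set set"
  assumes "V = {1..n}"
    and "simple_graph V E"
    and "card E \<ge> 2"
    and "l \<in> E"
    and "\<And>T p. (T, p) \<in> join_pairs_star V E \<Longrightarrow> join_representatives V E T p (S T p)"
    and "\<And>T p. (T, p) \<in> join_pairs_star V E \<Longrightarrow> K T p \<in> S T p"
  shows "minimal_homogeneous_generating_set E
           (eulerian_ideal V E :: (nat set, 'k::field) mpoly set)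
           ({(var e)\<^sup>2 - (var l)\<^sup>2 | e. e \<in> E - {l}} \<union>
            (\<Union>(T, p) \<in> join_pairs_star V E.
               {edge_monom J - edge_monom (K T p) | J. J \<in> S T p - {K T p}}))"
proof -
  interpret representative_choice V E l S K
    using assms by unfold_locales
  show ?thesis using generators_minimal unfolding generators_def .
qed

end
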